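(* Let $T^8=\mathbb{R}^8/\mathbb{Z}^8$, let $$A=\left(\begin{array}{rrrrrrrr}1&0&1&0&-1&-1&0&1\\0&-1&0&-1&-1&0&1&1\\-1&0&1&0&0&1&1&1\\0&1&0&-1&1&1&1&0\\1&1&0&-1&1&0&1&0\\1&0&-1&-1&0&-1&0&-1\\0&-1&-1&-1&-1&0&1&0\\-1&-1&-1&0&0&1&0&-1\end{array}\right)\in SL(8,\mathbb{Z}),$$ let $f_A$ be the diffeomorphism of $T^8$ defined by $A$, and let $S=S(T^8,f_A,\mathrm{id},\mathrm{id},\mathrm{id})$ be the corresponding toric suspension with its induced hypercomplex structure $(I,J,K)$. Then the hypercomplex manifold $S$ admits a quaternionic balanced metric, but admits no HKT metrics.
   Context: Hypercomplex structure on $T^8$: in terms of the standard basis $(e_1,\ldots,e_8)$ of $\mathbb{R}^8$, $(I,J,K=IJ)$ is given by $Ie_1=e_3,\ Ie_2=e_4,\ Ie_5=-e_7,\ Ie_6=-e_8$ and $Je_1=-e_5,\ Je_2=-e_6,\ Je_3=-e_7,\ Je_4=-e_8$ (extended by $I^2=J^2=-1$). The matrix $A$ commutes with $I,J,K$ and preserves $\mathbb{Z}^8$, so $(I,J,K)$ descends to $T^8$ and is preserved by $f_A$. Suspension: $S(T^8,f_A,\mathrm{id},\mathrm{id},\mathrm{id})$ is the quotient of $T^8\times\mathbb{R}^4$ by the action of $\mathbb{Z}^4$ whose first generator acts by $(p,x_1,x_2,x_3,x_4)\mapsto(f_A(p),x_1+1,x_2,x_3,x_4)$ and whose other three generators act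 trivially on $T^8$ and as unit translations in $x_2,x_3,x_4$ respectively. The hypercomplex structure on $S$ is induced by the product of the structure above on $T^8$ with the canonical hypercomplex structure on $\mathbb{R}^4=\mathbb{H}$. Thus $\dim_{\mathbb{R}}S=12$. A hyper-Hermitian metric on a hypercomplex manifold $(M,I,J,K)$ is a (positive-definite) Riemannian metric compatible with $I,J,K$; let $\omega_I,\omega_J,\omega_K$ be its fundamental forms and $\Omega=\omega_J+i\omega_K$, which is a $(2,0)$-form with respect to $I$. Let $\partial$ be the $(1,0)$-part of $d$ with respect to $I$. The metric is HKT (hyperkähler with torsion) if $\partial\Omega=0$, and is quaternionic balanced if $\partial(\Omega^{n-1})=0$, where $2n$ is the complex dimension of $M$ (so $n=3$ for $S$). *)

theory Defs
  imports "HOL-Analysis.Analysis"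
begin

section \<open>Smooth manifolds and hypercomplex structures\<close>

primrec Ck_on :: "nat \<Rightarrow> ('e::euclidean_space \<Rightarrow> 'b::real_normed_vector) \<Rightarrow> 'e set \<Rightarrow> bool" where
  "Ck_on 0 f U \<longleftrightarrow> continuous_on U f"
| "Ck_on (Suc k) f U \<longleftrightarrow> (\<forall>x\<in>U. f differentiable (at x)) \<and>
     (\<forall>v. Ck_on k (\<lambda>x. frechet_derivative f (at x) v) U)"

definition smooth_on :: "'e set \<Rightarrow> ('e::euclidean_space \<Rightarrow> 'b::real_normed_vector) \<Rightarrow> bool" where
  "smooth_on U f \<longleftrightarrow> (\<forall>k. Ck_on k f U)"

text \<open>A chart is a pair of its domain and its coordinate map; the coordinate map is only
  meaningful on the domain.\<close>

type_synonym ('m, 'e) chart = "'m set \<times> ('m \<Rightarrow> 'e)"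

definition chart_image :: "('m, 'e) chart \<Rightarrow> 'e set" where
  "chart_image c = snd c ` fst c"

definition overlap :: "('m, 'e) chart \<Rightarrow> ('m, 'e) chart \<Rightarrow> 'e set" where
  "overlap c d = snd c ` (fst c \<inter> fst d)"

definition transition :: "('m, 'e) chart \<Rightarrow> ('m, 'e) chart \<Rightarrow> 'e \<Rightarrow> 'e" where
  "transition c d = snd d \<circ> inv_into (fst c) (snd c)"

definition atlas_topology :: "('m, 'e::topological_space) chart set \<Rightarrow> 'm topology" where
  "atlas_topology A =
     topology (\<lambda>W. W \<subseteq> \<Union>(fst ` A) \<and> (\<forall>c\<in>A. open (snd c ` (fst c \<inter> W))))"

definition smooth_atlas :: "('m, 'e::euclidean_space) chart set \<Rightarrow> bool" where
  "smooth_atlas A \<longleftrightarrow>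
     (\<forall>c\<in>A. inj_on (snd c) (fst c) \<and> open (chart_image c)) \<and>
     (\<forall>c\<in>A. \<forall>d\<in>A. open (overlap c d) \<and> smooth_on (overlap c d) (transition c d)) \<and>
     Hausdorff_space (atlas_topology A) \<and> second_countable (atlas_topology A)"

text \<open>Tensor fields on a manifold are given by their coordinate representations in all charts of
  the atlas, subject to the transformation law under the differentials of the transition maps.
  A representation is only meaningful at the points of the image of the chart.\<close>

type_synonym ('m, 'e) endo_field = "('m, 'e) chart \<Rightarrow> 'e \<Rightarrow> 'e \<Rightarrow> 'e"
type_synonym ('m, 'e) bilinear_field = "('m, 'e) chart \<Rightarrow> 'e \<Rightarrow> 'e \<Rightarrow> 'e \<Rightarrow> real"

definition smooth_endo_field ::
  "('m, 'e::euclidean_space) chart set \<Rightarrow> ('m, 'e) endo_field \<Rightarrow> bool" where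
  "smooth_endo_field A T \<longleftrightarrow>
     (\<forall>c\<in>A. (\<forall>x\<in>chart_image c. linear (T c x)) \<and>
            (\<forall>v. smooth_on (chart_image c) (\<lambda>x. T c x v))) \<and>
     (\<forall>c\<in>A. \<forall>d\<in>A. \<forall>x\<in>overlap c d. \<forall>v.
        frechet_derivative (transition c d) (at x) (T c x v) =
        T d (transition c d x) (frechet_derivative (transition c d) (at x) v))"

text \<open>The Nijenhuis tensor \<open>[Tv,Tw] - T[Tv,w] - T[v,Tw] - [v,w]\<close> of an almost complex
  structure in a chart, on coordinate (constant) vector fields \<open>v\<close>, \<open>w\<close>.\<close>

definition nijenhuis :: "('e::euclidean_space \<Rightarrow> 'e \<Rightarrow> 'e) \<Rightarrow> 'e \<Rightarrow> 'e \<Rightarrow> 'e \<Rightarrow> 'e" where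
  "nijenhuis T x v w =
     (frechet_derivative (\<lambda>y. T y w) (at x) (T x v)
      - frechet_derivative (\<lambda>y. T y v) (at x) (T x w))
     + T x (frechet_derivative (\<lambda>y. T y v) (at x) w)
     - T x (frechet_derivative (\<lambda>y. T y w) (at x) v)"

definition complex_structure ::
  "('m, 'e::euclidean_space) chart set \<Rightarrow> ('m, 'e) endo_field \<Rightarrow> bool" where
  "complex_structure A T \<longleftrightarrow> smooth_endo_field A T \<and>
     (\<forall>c\<in>A. \<forall>x\<in>chart_image c.
        (\<forall>v. T c x (T c x v) = - v) \<and> (\<forall>v w. nijenhuis (T c) x v w = 0))"

record ('m, 'e) hypercomplex =
  Atlas :: "('m, 'e) chart set"
  cxI :: "('m, 'e) endo_field"
  cxJ :: "('m, 'e) endo_field"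
  cxK :: "('m, 'e) endo_field"

definition hypercomplex_manifold :: "('m, 'e::euclidean_space) hypercomplex \<Rightarrow> bool" where
  "hypercomplex_manifold M \<longleftrightarrow> smooth_atlas (Atlas M) \<and>
     complex_structure (Atlas M) (cxI M) \<and> complex_structure (Atlas M) (cxJ M) \<and>
     complex_structure (Atlas M) (cxK M) \<and>
     (\<forall>c\<in>Atlas M. \<forall>x\<in>chart_image c. \<forall>v.
        cxI M c x (cxJ M c x v) = cxK M c x v \<and> cxJ M c x (cxI M c x v) = - cxK M c x v)"


section \<open>Complex differential forms\<close>

text \<open>The coordinate representation of a complex-valued \<open>k\<close>-form takes a point and vectors
  \<open>v 0, \<dots>, v (k - 1)\<close>; the further values of \<open>v\<close> are irrelevant.\<close>

type_synonym 'e form = "'e \<Rightarrow> (nat \<Rightarrow> 'e) \<Rightarrow> complex"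

definition ext_deriv :: "nat \<Rightarrow> 'e::euclidean_space form \<Rightarrow> 'e form" where
  "ext_deriv k \<omega> x v =
     (\<Sum>i\<le>k. (-1) ^ i *
        frechet_derivative (\<lambda>y. \<omega> y (\<lambda>j. if j < i then v j else v (Suc j))) (at x) (v i))"

definition wedge :: "nat \<Rightarrow> nat \<Rightarrow> 'e form \<Rightarrow> 'e form \<Rightarrow> 'e form" where
  "wedge p q \<alpha> \<beta> x v =
     (\<Sum>\<sigma> | \<sigma> permutes {..<p + q}.
        of_int (sign \<sigma>) * \<alpha> x (\<lambda>i. v (\<sigma> i)) * \<beta> x (\<lambda>j. v (\<sigma> (p + j)))) / (fact p * fact q)"

primrec two_form_power :: "'e form \<Rightarrow> nat \<Rightarrow> 'e form" where
  "two_form_power \<omega> 0 = (\<lambda>x v. 1)"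
| "two_form_power \<omega> (Suc m) = wedge (2 * m) 2 (two_form_power \<omega> m) \<omega>"

text \<open>The component of type \<open>(p, k - p)\<close> of a \<open>k\<close>-form \<open>\<alpha>\<close> at a point, with respect to the
  complex structure \<open>T\<close> on the tangent space. With \<open>v\<^sup>1\<^sup>,\<^sup>0 = (v - \<i> T v) / 2\<close> and
  \<open>v\<^sup>0\<^sup>,\<^sup>1 = (v + \<i> T v) / 2\<close>, it is the sum over the sets \<open>S\<close> of \<open>p\<close> slots of the
  complex multilinear extension of \<open>\<alpha>\<close> evaluated at \<open>(v j)\<^sup>1\<^sup>,\<^sup>0\<close> for \<open>j \<in> S\<close> and
  \<open>(v j)\<^sup>0\<^sup>,\<^sup>1\<close> for \<open>j \<notin> S\<close>; expanding, \<open>R\<close> is the set of slots where \<open>T\<close> is applied.\<close>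

definition type_component ::
  "('e \<Rightarrow> 'e) \<Rightarrow> nat \<Rightarrow> nat \<Rightarrow> ((nat \<Rightarrow> 'e) \<Rightarrow> complex) \<Rightarrow> (nat \<Rightarrow> 'e) \<Rightarrow> complex" where
  "type_component T k p \<alpha> v =
     (\<Sum>S | S \<subseteq> {..<k} \<and> card S = p. \<Sum>R\<in>Pow {..<k}.
        (\<Prod>j\<in>R. if j \<in> S then - \<i> else \<i>) / 2 ^ k * \<alpha> (\<lambda>j. if j \<in> R then T (v j) else v j))"

text \<open>The \<open>(1,0)\<close>-part of the exterior derivative with respect to \<open>T\<close>: it maps the
  component of type \<open>(p,q)\<close> to the component of type \<open>(p + 1,q)\<close> of its exterior derivative.\<close>

definition del :: "('e::euclidean_space \<Rightarrow> 'e \<Rightarrow> 'e) \<Rightarrow> nat \<Rightarrow> 'e form \<Rightarrow> 'e form" where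
  "del T k \<omega> x =
     (\<lambda>v. \<Sum>p\<le>k. type_component (T x) (Suc k) (Suc p)
        (ext_deriv k (\<lambda>y. type_component (T y) k p (\<omega> y)) x) v)"


section \<open>Hyper-Hermitian metrics\<close>

definition riemannian_metric ::
  "('m, 'e::euclidean_space) chart set \<Rightarrow> ('m, 'e) bilinear_field \<Rightarrow> bool" where
  "riemannian_metric A g \<longleftrightarrow>
     (\<forall>c\<in>A. (\<forall>v w. smooth_on (chart_image c) (\<lambda>x. g c x v w)) \<and>
        (\<forall>x\<in>chart_image c. bilinear (g c x) \<and> (\<forall>v w. g c x v w = g c x w v) \<and>
           (\<forall>v. v \<noteq> 0 \<longrightarrow> g c x v v > 0))) \<and>
     (\<forall>c\<in>A. \<forall>d\<in>A. \<forall>x\<in>overlap c d. \<forall>v w.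
        g d (transition c d x) (frechet_derivative (transition c d) (at x) v)
          (frechet_derivative (transition c d) (at x) w) = g c x v w)"

definition hyper_hermitian_metric ::
  "('m, 'e::euclidean_space) hypercomplex \<Rightarrow> ('m, 'e) bilinear_field \<Rightarrow> bool" where
  "hyper_hermitian_metric M g \<longleftrightarrow> riemannian_metric (Atlas M) g \<and>
     (\<forall>T\<in>{cxI M, cxJ M, cxK M}. \<forall>c\<in>Atlas M. \<forall>x\<in>chart_image c. \<forall>v w.
        g c x (T c x v) (T c x w) = g c x v w)"

definition fundamental_form ::
  "('m, 'e) endo_field \<Rightarrow> ('m, 'e) bilinear_field \<Rightarrow> ('m, 'e) chart \<Rightarrow> 'e \<Rightarrow> 'e \<Rightarrow> 'e \<Rightarrow> real" where
  "fundamental_form T g c x v w = g c x (T c x v) w"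

definition Omega ::
  "('m, 'e) hypercomplex \<Rightarrow> ('m, 'e) bilinear_field \<Rightarrow> ('m, 'e) chart \<Rightarrow> 'e form" where
  "Omega M g c x v =
     complex_of_real (fundamental_form (cxJ M) g c x (v 0) (v 1)) +
     \<i> * complex_of_real (fundamental_form (cxK M) g c x (v 0) (v 1))"

definition HKT_metric ::
  "('m, 'e::euclidean_space) hypercomplex \<Rightarrow> ('m, 'e) bilinear_field \<Rightarrow> bool" where
  "HKT_metric M g \<longleftrightarrow> hyper_hermitian_metric M g \<and>
     (\<forall>c\<in>Atlas M. \<forall>x\<in>chart_image c. \<forall>v. del (cxI M c) 2 (Omega M g c) x v = 0)"

text \<open>Here \<open>n\<close> is half the complex dimension, that is a quarter of the real dimension.\<close>

definition quaternionic_balanced_metric ::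
  "('m, 'e::euclidean_space) hypercomplex \<Rightarrow> ('m, 'e) bilinear_field \<Rightarrow> bool" where
  "quaternionic_balanced_metric M g \<longleftrightarrow> hyper_hermitian_metric M g \<and>
     (let n = DIM('e) div 4 in
      \<forall>c\<in>Atlas M. \<forall>x\<in>chart_image c. \<forall>v.
        del (cxI M c) (2 * (n - 1)) (two_form_power (Omega M g c) (n - 1)) x v = 0)"


section \<open>The torus and its suspension\<close>

text \<open>In the index type \<open>8\<close> the index \<open>8\<close> coincides with \<open>0\<close>, so that \<open>1, \<dots>, 8\<close>
  enumerates all indices, and likewise for the index type \<open>4\<close>.\<close>

definition A_mat :: "real^8^8" where
  "A_mat = vector
    [vector [ 1,  0,  1,  0, -1, -1,  0,  1],
     vector [ 0, -1,  0, -1, -1,  0,  1,  1],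
     vector [-1,  0,  1,  0,  0,  1,  1,  1],
     vector [ 0,  1,  0, -1,  1,  1,  1,  0],
     vector [ 1,  1,  0, -1,  1,  0,  1,  0],
     vector [ 1,  0, -1, -1,  0, -1,  0, -1],
     vector [ 0, -1, -1, -1, -1,  0,  1,  0],
     vector [-1, -1, -1,  0,  0,  1,  0, -1]]"

definition torus_proj :: "real^8 \<Rightarrow> (real^8) set" where
  "torus_proj v = {w. \<forall>i. w $ i - v $ i \<in> \<int>}"

definition T8 :: "(real^8) set set" where
  "T8 = range torus_proj"

text \<open>The map on \<open>T8\<close> induced by \<open>A_mat\<close>: the image of a coset of the integer lattice is again
  such a coset. As a map on all subsets it is a bijection too, so \<open>inv f_A\<close> restricts to
  its inverse on \<open>T8\<close>.\<close>

definition f_A :: "(real^8) set \<Rightarrow> (real^8) set" where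
  "f_A P = (\<lambda>v. A_mat *v v) ` P"

definition int_iterate :: "('a \<Rightarrow> 'a) \<Rightarrow> int \<Rightarrow> 'a \<Rightarrow> 'a" where
  "int_iterate f k = (if k \<ge> 0 then f ^^ nat k else inv f ^^ nat (- k))"

definition suspension_action ::
  "int^4 \<Rightarrow> (real^8) set \<times> (real^4) \<Rightarrow> (real^8) set \<times> (real^4)" where
  "suspension_action m = (\<lambda>(P, x). (int_iterate f_A (m $ 1) P, x + (\<chi> i. of_int (m $ i))))"

definition orbit_relation ::
  "(((real^8) set \<times> (real^4)) \<times> ((real^8) set \<times> (real^4))) set" where
  "orbit_relation =
     {(s, t). s \<in> T8 \<times> UNIV \<and> t \<in> T8 \<times> UNIV \<and> (\<exists>m. t = suspension_action m s)}"

type_synonym suspension_point = "((real^8) set \<times> (real^4)) set"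

definition S_carrier :: "suspension_point set" where
  "S_carrier = (T8 \<times> UNIV) // orbit_relation"

definition S_proj :: "(real^8) \<times> (real^4) \<Rightarrow> suspension_point" where
  "S_proj = (\<lambda>(v, x). orbit_relation `` {(torus_proj v, x)})"

definition I8 :: "real^8 \<Rightarrow> real^8" where
  "I8 v = vector [- v$3, - v$4, v$1, v$2, v$7, v$8, - v$5, - v$6]"

definition J8 :: "real^8 \<Rightarrow> real^8" where
  "J8 v = vector [v$5, v$6, v$7, v$8, - v$1, - v$2, - v$3, - v$4]"

text \<open>On \<open>real^4\<close>, identified with the quaternions through the basis \<open>1, i, j, k\<close>, the canonical
  hypercomplex structure is given by the left multiplications by \<open>i\<close> and \<open>j\<close>.\<close>

definition I4 :: "real^4 \<Rightarrow> real^4" where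
  "I4 x = vector [- x$2, x$1, - x$4, x$3]"

definition J4 :: "real^4 \<Rightarrow> real^4" where
  "J4 x = vector [- x$3, x$4, x$1, - x$2]"

text \<open>The suspension as a hypercomplex manifold: its charts are the local inverses of the covering
  map \<open>S_proj\<close> from \<open>real^8 \<times> real^4\<close>. In these charts the product hypercomplex structure has
  constant coefficients.\<close>

definition suspension_S ::
  "(suspension_point, (real^8) \<times> (real^4)) hypercomplex" where
  "suspension_S =
     \<lparr>Atlas = {(S_proj ` W, inv_into W S_proj) | W. open W \<and> inj_on S_proj W},
      cxI = (\<lambda>c p. \<lambda>(v, x). (I8 v, I4 x)),
      cxJ = (\<lambda>c p. \<lambda>(v, x). (J8 v, J4 x)),
      cxK = (\<lambda>c p. \<lambda>(v, x). (I8 (J8 v), I4 (J4 x)))\<rparr>"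


section \<open>The suspension is a hypercomplex manifold\<close>

lemma vector_8:
  "(vector [a,b,c,d,e,f,g,h] :: ('a::zero)^8) $ 1 = a"
  "(vector [a,b,c,d,e,f,g,h] :: ('a::zero)^8) $ 2 = b"
  "(vector [a,b,c,d,e,f,g,h] :: ('a::zero)^8) $ 3 = c"
  "(vector [a,b,c,d,e,f,g,h] :: ('a::zero)^8) $ 4 = d"
  "(vector [a,b,c,d,e,f,g,h] :: ('a::zero)^8) $ 5 = e"
  "(vector [a,b,c,d,e,f,g,h] :: ('a::zero)^8) $ 6 = f"
  "(vector [a,b,c,d,e,f,g,h] :: ('a::zero)^8) $ 7 = g"
  "(vector [a,b,c,d,e,f,g,h] :: ('a::zero)^8) $ 8 = h"
  unfolding vector_def by simp_all

lemma vector_4: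
  "(vector [a,b,c,d] :: ('a::zero)^4) $ 1 = a"
  "(vector [a,b,c,d] :: ('a::zero)^4) $ 2 = b"
  "(vector [a,b,c,d] :: ('a::zero)^4) $ 3 = c"
  "(vector [a,b,c,d] :: ('a::zero)^4) $ 4 = d"
  unfolding vector_def by simp_all

lemma UNIV_8: "(UNIV::8 set) = {1,2,3,4,5,6,7,8}"
  by (rule sym, rule card_subset_eq) simp_all

lemma forall_8: "(\<forall>i::8. P i) \<longleftrightarrow> P 1 \<and> P 2 \<and> P 3 \<and> P 4 \<and> P 5 \<and> P 6 \<and> P 7 \<and> P 8"
proof -
  have "(\<forall>i::8. P i) \<longleftrightarrow> (\<forall>i\<in>UNIV. P i)" by simp
  then show ?thesis unfolding UNIV_8 by simp
qed

lemma sum_8: "sum f (UNIV::8 set) = f 1 + f 2 + f 3 + f 4 + f 5 + f 6 + f 7 + f 8"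
  unfolding UNIV_8 by (simp add: add.assoc)

lemma I8_basis:
  "I8 (axis 1 1) = axis 3 1" "I8 (axis 2 1) = axis 4 1"
  "I8 (axis 5 1) = - axis 7 1" "I8 (axis 6 1) = - axis 8 1"
  by (simp_all add: I8_def vec_eq_iff forall_8 vector_8 axis_def)

lemma J8_basis:
  "J8 (axis 1 1) = - axis 5 1" "J8 (axis 2 1) = - axis 6 1"
  "J8 (axis 3 1) = - axis 7 1" "J8 (axis 4 1) = - axis 8 1"
  by (simp_all add: J8_def vec_eq_iff forall_8 vector_8 axis_def)

lemma IJ8_relations:
  "I8 (I8 v) = - v" "J8 (J8 v) = - v" "J8 (I8 v) = - I8 (J8 v)"
  by (simp_all add: I8_def J8_def vec_eq_iff forall_8 vector_8)

lemma IJ4_relations: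
  "I4 (I4 v) = - v" "J4 (J4 v) = - v" "J4 (I4 v) = - I4 (J4 v)"
  by (simp_all add: I4_def J4_def vec_eq_iff forall_4 vector_4)

lemma linear_IJ: "linear I8" "linear J8" "linear I4" "linear J4"
  by (rule linearI; simp add: I8_def J8_def I4_def J4_def vec_eq_iff forall_8 vector_8 forall_4 vector_4)+

lemma A_mat_mult:
  "A_mat *v v = vector
    [v$1 + v$3 - v$5 - v$6 + v$8,
     - v$2 - v$4 - v$5 + v$7 + v$8,
     - v$1 + v$3 + v$6 + v$7 + v$8,
     v$2 - v$4 + v$5 + v$6 + v$7,
     v$1 + v$2 - v$4 + v$5 + v$7,
     v$1 - v$3 - v$4 - v$6 - v$8,
     - v$2 - v$3 - v$4 - v$5 + v$7,
     - v$1 - v$2 - v$3 + v$6 - v$8]"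
  by (simp add: A_mat_def matrix_vector_mult_def vec_eq_iff forall_8 vector_8 sum_8)

definition A_inv :: "real^8 \<Rightarrow> real^8" where
  "A_inv v = vector
    [v$1 - v$3 + v$5 - v$6 + v$8,
     - v$2 + v$4 - v$5 + v$7 - v$8,
     v$1 + v$3 + v$6 - v$7 + v$8,
     - v$2 - v$4 + v$5 - v$6 + v$7,
     - v$1 + v$2 - v$4 + v$5 - v$7,
     v$1 - v$3 + v$4 - v$6 + v$8,
     - v$2 + v$3 - v$4 + v$5 + v$7,
     - v$1 + v$2 - v$3 - v$6 - v$8]"

lemma A_inv: "A_mat *v A_inv v = v" "A_inv (A_mat *v v) = v"
  unfolding A_mat_mult A_inv_def
  by (simp_all add: vec_eq_iff forall_8 vector_8)

lemma A_mat_I8: "A_mat *v I8 v = I8 (A_mat *v v)"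
  and A_mat_J8: "A_mat *v J8 v = J8 (A_mat *v v)"
  unfolding A_mat_mult I8_def J8_def by (simp_all add: vec_eq_iff forall_8 vector_8)

definition lattice :: "(real^'n) set" where
  "lattice = {v. \<forall>i. v $ i \<in> \<int>}"

lemma A_mat_lattice: "v \<in> lattice \<Longrightarrow> A_mat *v v \<in> lattice"
  and A_inv_lattice: "v \<in> lattice \<Longrightarrow> A_inv v \<in> lattice"
  unfolding A_mat_mult A_inv_def lattice_def by (simp_all add: forall_8 vector_8)

lemma bij_A: "bij ((*v) A_mat)" and inv_A: "inv ((*v) A_mat) = A_inv"
proof -
  show "bij ((*v) A_mat)" by (rule bij_betw_byWitness[where f' = A_inv]) (auto simp: A_inv)
  then show "inv ((*v) A_mat) = A_inv" by (intro inv_equality) (auto simp: A_inv)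
qed

lemma linear_A_inv: "linear A_inv"
  unfolding A_inv_def by (rule linearI) (simp_all add: vec_eq_iff forall_8 vector_8 algebra_simps)

lemma f_A_conv: "f_A = (`) ((*v) A_mat)" by (auto simp: f_A_def fun_eq_iff)
lemma bij_f_A: "bij f_A" and inv_f_A: "inv f_A = (`) A_inv"
proof -
  show b: "bij f_A" unfolding f_A_conv
    by (rule bij_betw_byWitness[where f' = "(`) A_inv"]) (auto simp: A_inv image_image)
  show "inv f_A = (`) A_inv"
    unfolding f_A_conv by (intro inv_equality) (auto simp: A_inv image_image)
qed

lemma int_iterate_0: "int_iterate f 0 x = x" by (simp add: int_iterate_def)

lemma int_iterate_Suc: assumes "bij f" shows "int_iterate f (k + 1) x = f (int_iterate f k x)"
proof (cases "k \<ge> 0")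
  case True
  then have "nat (k + 1) = Suc (nat k)" by simp
  then show ?thesis using True by (simp add: int_iterate_def)
next
  case False
  define j where "j = nat (- k - 1)"
  have k: "k = - int (Suc j)" using False by (simp add: j_def)
  have "f (inv f y) = y" for y using assms by (meson bij_inv_eq_iff)
  moreover have "nat (int j) = j" "nat (1 + int j) = Suc j" "nat (int j + 1) = Suc j" by simp_all
  ultimately show ?thesis unfolding k int_iterate_def by (cases "j = 0") simp_all
qed

lemma int_iterate_pred: assumes "bij f" shows "int_iterate f (k - 1) x = inv f (int_iterate f k x)"
  using int_iterate_Suc[OF assms, of "k - 1" x] assms by (simp add: bij_is_inj inv_f_f)

lemma int_iterate_add: assumes "bij f"
  shows "int_iterate f (a + b) x = int_iterate f a (int_iterate f b x)"
proof (induction a rule: int_induct[of _ 0])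
  case base then show ?case by (simp add: int_iterate_0)
next
  case (step1 i)
  have "int_iterate f (i + 1 + b) x = int_iterate f (i + b + 1) x" by (simp add: algebra_simps)
  then show ?case using step1 by (simp add: int_iterate_Suc[OF assms])
next
  case (step2 i)
  have "int_iterate f (i - 1 + b) x = int_iterate f (i + b - 1) x" by (simp add: algebra_simps)
  then show ?case using step2 by (simp add: int_iterate_pred[OF assms])
qed

definition A_pow :: "int \<Rightarrow> real^8 \<Rightarrow> real^8" where "A_pow k = int_iterate ((*v) A_mat) k"

lemma A_pow_Suc: "A_pow (k + 1) v = A_mat *v A_pow k v"
  and A_pow_pred: "A_pow (k - 1) v = A_inv (A_pow k v)"
  and A_pow_add: "A_pow (a + b) v = A_pow a (A_pow b v)"
  and A_pow_0: "A_pow 0 v = v"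
  unfolding A_pow_def
  by (rule int_iterate_Suc[OF bij_A], rule int_iterate_pred[OF bij_A, unfolded inv_A],
      rule int_iterate_add[OF bij_A], rule int_iterate_0)

lemma A_pow_props:
  "linear (A_pow k) \<and> A_pow k ` lattice \<subseteq> lattice \<and>
   (\<forall>v. A_pow k (I8 v) = I8 (A_pow k v) \<and> A_pow k (J8 v) = J8 (A_pow k v)) \<and>
   (\<forall>v. int_iterate f_A k (torus_proj v) = torus_proj (A_pow k v))"
proof (induction k rule: int_induct[of _ 0])
  case base
  show ?case by (auto simp: A_pow_0 int_iterate_0 linear_iff)
next
  case (step1 i)
  have e: "A_pow (i + 1) = (\<lambda>v. A_mat *v (A_pow i v))" by (simp add: fun_eq_iff A_pow_Suc)
  have l: "linear (\<lambda>v. A_mat *v (A_pow i v))"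
    using step1 linear_compose[of "A_pow i" "(*v) A_mat"] by (simp add: o_def)
  have t: "f_A (torus_proj v) = torus_proj (A_mat *v v)" for v
  proof -
    have "w \<in> f_A (torus_proj v)" if "w - A_mat *v v \<in> lattice" for w
    proof -
      have "A_inv w - v \<in> lattice"
        using A_inv_lattice[OF that] linear_diff[OF linear_A_inv] by (simp add: A_inv)
      then show ?thesis unfolding f_A_def torus_proj_def lattice_def
        by (intro image_eqI[of _ _ "A_inv w"]) (auto simp: A_inv)
    qed
    moreover have "A_mat *v w - A_mat *v v \<in> lattice" if "w - v \<in> lattice" for w
      using A_mat_lattice[OF that] by (simp add: matrix_vector_mult_diff_distrib)
    ultimately show ?thesis unfolding f_A_def torus_proj_def lattice_def by auto
  qed
  show ?case using step1 unfolding e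
    by (auto simp: l A_mat_I8 A_mat_J8 A_mat_lattice int_iterate_Suc[OF bij_f_A] t)
next
  case (step2 i)
  have e: "A_pow (i - 1) = (\<lambda>v. A_inv (A_pow i v))" by (simp add: fun_eq_iff A_pow_pred)
  have l: "linear (\<lambda>v. A_inv (A_pow i v))"
    using step2 linear_compose[of "A_pow i" A_inv] linear_A_inv by (simp add: o_def)
  have I: "A_inv (I8 v) = I8 (A_inv v)" and J: "A_inv (J8 v) = J8 (A_inv v)" for v
    using A_mat_I8[of "A_inv v"] A_mat_J8[of "A_inv v"] by (metis A_inv)+
  have t: "A_inv ` (torus_proj v) = torus_proj (A_inv v)" for v
  proof -
    have "w \<in> A_inv ` (torus_proj v)" if "w - A_inv v \<in> lattice" for w
    proof -
      have "A_mat *v w - v \<in> lattice"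
        using A_mat_lattice[OF that] by (simp add: A_inv matrix_vector_mult_diff_distrib)
      then show ?thesis unfolding torus_proj_def lattice_def
        by (intro image_eqI[of _ _ "A_mat *v w"]) (auto simp: A_inv)
    qed
    moreover have "A_inv w - A_inv v \<in> lattice" if "w - v \<in> lattice" for w
      using A_inv_lattice[OF that] linear_diff[OF linear_A_inv] by simp
    ultimately show ?thesis unfolding torus_proj_def lattice_def by auto
  qed
  show ?case using step2 unfolding e
    by (auto simp: l I J A_inv_lattice int_iterate_pred[OF bij_f_A] inv_f_A t)
qed

lemma linear_A_pow: "linear (A_pow k)"
  and A_pow_lattice: "v \<in> lattice \<Longrightarrow> A_pow k v \<in> lattice"
  and A_pow_I8: "A_pow k (I8 v) = I8 (A_pow k v)"
  and A_pow_J8: "A_pow k (J8 v) = J8 (A_pow k v)"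
  and f_A_pow: "int_iterate f_A k (torus_proj v) = torus_proj (A_pow k v)"
  using A_pow_props[of k] by auto

lemma lattice_add: "v \<in> lattice \<Longrightarrow> w \<in> lattice \<Longrightarrow> v + w \<in> lattice"
  and lattice_diff: "v \<in> lattice \<Longrightarrow> w \<in> lattice \<Longrightarrow> v - w \<in> lattice"
  and lattice_0: "0 \<in> lattice"
  and lattice_minus: "v \<in> lattice \<Longrightarrow> - v \<in> lattice"
  unfolding lattice_def by auto

lemma torus_proj_eq_iff: "torus_proj v = torus_proj w \<longleftrightarrow> w - v \<in> lattice"
proof
  assume "torus_proj v = torus_proj w"
  moreover have "w \<in> torus_proj w" by (simp add: torus_proj_def)
  ultimately show "w - v \<in> lattice" by (auto simp: torus_proj_def lattice_def)
next
  assume a: "w - v \<in> lattice"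
  have "(u - v \<in> lattice) = (u - w \<in> lattice)" for u
    using lattice_add[OF _ a, of "u - w"] lattice_diff[OF _ a, of "u - v"] by auto
  then show "torus_proj v = torus_proj w" by (auto simp: torus_proj_def lattice_def)
qed

definition of_int_vec :: "int^'n \<Rightarrow> real^'n" where "of_int_vec m = (\<chi> i. of_int (m $ i))"

lemma of_int_vec_simps: "of_int_vec (a + b) = of_int_vec a + of_int_vec b" "of_int_vec 0 = 0"
  "of_int_vec (- a) = - of_int_vec a"
  by (simp_all add: of_int_vec_def vec_eq_iff)

definition deck :: "int^4 \<Rightarrow> real^8 \<Rightarrow> (real^8) \<times> (real^4) \<Rightarrow> (real^8) \<times> (real^4)" where
  "deck m n = (\<lambda>(v, x). (A_pow (m $ 1) v + n, x + of_int_vec m))"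

lemma action_torus: "suspension_action m (torus_proj v, x) =
   (torus_proj (A_pow (m $ 1) v), x + of_int_vec m)"
  by (simp add: suspension_action_def f_A_pow of_int_vec_def)

lemma equiv_orbit: "equiv (T8 \<times> UNIV) orbit_relation"
proof -
  have add: "suspension_action a (suspension_action b s) = suspension_action (a + b) s"
    for a b s
    by (cases s) (simp add: suspension_action_def int_iterate_add[OF bij_f_A] vec_eq_iff)
  have zero: "suspension_action 0 s = s" for s
    by (cases s) (simp add: suspension_action_def int_iterate_0 vec_eq_iff)
  have r: "refl_on (T8 \<times> UNIV) orbit_relation"
    unfolding orbit_relation_def refl_on_def by (auto intro: exI[of _ 0] simp: zero)
  have s: "sym orbit_relation"
  proof (rule symI)
    fix s t assume "(s, t) \<in> orbit_relation"
    then obtain m where "s \<in> T8 \<times> UNIV" "t \<in> T8 \<times> UNIV" "t = suspension_action m s"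
      unfolding orbit_relation_def by blast
    moreover from this have "s = suspension_action (- m) t" by (simp add: add zero)
    ultimately show "(t, s) \<in> orbit_relation" unfolding orbit_relation_def by blast
  qed
  have t: "trans orbit_relation"
    by (rule transI) (auto simp: orbit_relation_def add)
  show ?thesis using r s t by (auto simp: equiv_def orbit_relation_def)
qed

lemma S_proj_eq_iff: "S_proj y = S_proj z \<longleftrightarrow> (\<exists>m. \<exists>n\<in>lattice. z = deck m n y)"
proof -
  obtain v x where y: "y = (v, x)" by fastforce
  obtain w u where z: "z = (w, u)" by fastforce
  have "S_proj y = S_proj z \<longleftrightarrow> ((torus_proj v, x), (torus_proj w, u)) \<in> orbit_relation"
    unfolding y z S_proj_def by (simp add: eq_equiv_class_iff[OF equiv_orbit] T8_def)
  also have "\<dots> \<longleftrightarrow> (\<exists>m. u = x + of_int_vec m \<and> w - A_pow (m $ 1) v \<in> lattice)"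
    unfolding orbit_relation_def
    by (auto simp: T8_def action_torus torus_proj_eq_iff[symmetric])
  also have "\<dots> \<longleftrightarrow> (\<exists>m. \<exists>n\<in>lattice. z = deck m n y)"
  proof safe
    fix m assume "u = x + of_int_vec m" "w - A_pow (m $ 1) v \<in> lattice"
    then show "\<exists>m. \<exists>n\<in>lattice. z = deck m n y" unfolding y z deck_def
      by (intro exI[of _ m] bexI[of _ "w - A_pow (m $ 1) v"]) auto
  next
    fix m n assume "n \<in> lattice" "z = deck m n y"
    then show "\<exists>m. u = x + of_int_vec m \<and> w - A_pow (m $ 1) v \<in> lattice"
      unfolding y z deck_def by auto
  qed
  finally show ?thesis .
qed

lemma S_carrier_conv: "S_carrier = range S_proj"
  unfolding S_carrier_def S_proj_def T8_def quotient_def by (auto simp: image_iff)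

lemma has_derivative_frechet:
  assumes "bounded_linear l" "open N" "x \<in> N" "\<And>z. z \<in> N \<Longrightarrow> f z = l z + c"
  shows "(f has_derivative l) (at x)" and "frechet_derivative f (at x) = l"
proof -
  have "((\<lambda>z. l z + c) has_derivative l) (at x)"
    using assms(1) by (auto intro!: derivative_eq_intros bounded_linear_imp_has_derivative)
  then show d: "(f has_derivative l) (at x)"
    by (rule has_derivative_transform_within_open[OF _ assms(2,3)]) (simp add: assms(4))
  show "frechet_derivative f (at x) = l" using frechet_derivative_at[OF d] by simp
qed

lemma Ck_on_locally_affine:
  assumes "\<And>x. x \<in> U \<Longrightarrow> \<exists>N l c. open N \<and> x \<in> N \<and> N \<subseteq> U \<and> bounded_linear l \<and> (\<forall>z\<in>N. f z = l z + c)"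
  shows "Ck_on k f U"
  using assms
proof (induction k arbitrary: f)
  case 0
  have "isCont f x" if xU: "x \<in> U" for x
  proof -
    obtain N l c where "open N" "x \<in> N" "bounded_linear l" "\<forall>z\<in>N. f z = l z + c"
      using 0[OF xU] by blast
    then have "(f has_derivative l) (at x)" by (intro has_derivative_frechet(1)[of l N x f c]) auto
    then show ?thesis by (rule has_derivative_continuous)
  qed
  then show ?case by (simp add: continuous_at_imp_continuous_on)
next
  case (Suc k)
  have "f differentiable (at x)" if xU: "x \<in> U" for x
  proof -
    obtain N l c where "open N" "x \<in> N" "bounded_linear l" "\<forall>z\<in>N. f z = l z + c"
      using Suc.prems[OF xU] by blast
    then have "(f has_derivative l) (at x)" by (intro has_derivative_frechet(1)[of l N x f c]) auto
    then show ?thesis by (rule differentiableI)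
  qed
  moreover have "Ck_on k (\<lambda>x. frechet_derivative f (at x) v) U" for v
  proof (rule Suc.IH)
    fix x assume xU: "x \<in> U"
    obtain N l c where N: "open N" "x \<in> N" "N \<subseteq> U" "bounded_linear l" "\<forall>z\<in>N. f z = l z + c"
      using Suc.prems[OF xU] by blast
    have "frechet_derivative f (at z) v = 0 + l v" if "z \<in> N" for z
      using has_derivative_frechet(2)[OF N(4,1) that, of f c] N(5) by simp
    then show "\<exists>N l c. open N \<and> x \<in> N \<and> N \<subseteq> U \<and> bounded_linear l \<and>
        (\<forall>z\<in>N. frechet_derivative f (at z) v = l z + c)"
      using N(1-3) bounded_linear_zero by (intro exI[of _ N] exI[of _ "\<lambda>_. 0"] exI[of _ "l v"]) auto
  qed
  ultimately show ?case by simp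
qed

lemma smooth_on_const: "open U \<Longrightarrow> smooth_on U (\<lambda>x. a)"
  unfolding smooth_on_def
  by (intro allI Ck_on_locally_affine)
     (metis add_0 bounded_linear_zero order_refl)

definition deck_lin :: "int^4 \<Rightarrow> (real^8) \<times> (real^4) \<Rightarrow> (real^8) \<times> (real^4)" where
  "deck_lin m = (\<lambda>(v, x). (A_pow (m $ 1) v, x))"

lemma deck_affine: "deck m n y = deck_lin m y + (n, of_int_vec m)"
  by (cases y) (simp add: deck_def deck_lin_def)

lemma bounded_linear_deck_lin: "bounded_linear (deck_lin m)"
proof -
  have "bounded_linear (\<lambda>p::(real^8) \<times> (real^4). (A_pow (m $ 1) (fst p), snd p))"
    by (intro bounded_linear_Pair bounded_linear_snd
        bounded_linear_compose[OF linear_conv_bounded_linear[THEN iffD1, OF linear_A_pow]]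
        bounded_linear_fst)
  then show ?thesis by (simp add: deck_lin_def case_prod_unfold)
qed

lemma continuous_deck: "continuous_on X (deck m n)"
proof -
  have "continuous_on X (\<lambda>y. deck_lin m y + (n, of_int_vec m))"
    by (intro continuous_intros linear_continuous_on bounded_linear_deck_lin)
  then show ?thesis by (simp add: deck_affine fun_eq_iff[symmetric] cong: continuous_on_cong)
qed

lemma S_proj_deck: "n \<in> lattice \<Longrightarrow> S_proj (deck m n y) = S_proj y"
  using S_proj_eq_iff[of y "deck m n y"] by auto

lemma open_saturation:
  assumes "open V" shows "open {y. S_proj y \<in> S_proj ` V}"
proof -
  have "{y. S_proj y \<in> S_proj ` V} = (\<Union>m. \<Union>n\<in>lattice. deck m n -` V)"
  proof (rule set_eqI)
    fix y
    have "S_proj y \<in> S_proj ` V \<longleftrightarrow> (\<exists>z\<in>V. \<exists>m. \<exists>n\<in>lattice. z = deck m n y)"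
      unfolding image_iff Bex_def S_proj_eq_iff ..
    also have "\<dots> \<longleftrightarrow> (\<exists>m. \<exists>n\<in>lattice. deck m n y \<in> V)" by blast
    finally show "y \<in> {y. S_proj y \<in> S_proj ` V} \<longleftrightarrow> y \<in> (\<Union>m. \<Union>n\<in>lattice. deck m n -` V)"
      by simp
  qed
  moreover have "open (deck m n -` V)" for m n
    using continuous_deck[of UNIV m n] assms by (simp add: open_vimage)
  ultimately show ?thesis by (simp add: open_UN)
qed

abbreviation S_atlas where "S_atlas \<equiv> Atlas suspension_S"

lemma S_atlas_E:
  assumes "c \<in> S_atlas"
  obtains W where "open W" "inj_on S_proj W" "c = (S_proj ` W, inv_into W S_proj)"
  using assms by (auto simp: suspension_S_def)

lemma chart_image_S:
  assumes "inj_on S_proj W"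
  shows "inv_into W S_proj ` (S_proj ` W \<inter> V) = {y\<in>W. S_proj y \<in> V}"
  using assms by (force simp: image_iff)

lemma transition_locally_deck:
  assumes W: "open W" "inj_on S_proj W" and V: "open V" "inj_on S_proj V"
    and c: "c = (S_proj ` W, inv_into W S_proj)" and d: "d = (S_proj ` V, inv_into V S_proj)"
    and y: "y \<in> overlap c d"
  obtains m n N where "open N" "y \<in> N" "N \<subseteq> overlap c d" "n \<in> lattice"
    "\<And>z. z \<in> N \<Longrightarrow> transition c d z = deck m n z"
proof -
  have o: "overlap c d = {y\<in>W. S_proj y \<in> S_proj ` V}"
    unfolding overlap_def c d by (simp add: chart_image_S[OF W(2)])
  then obtain m n where mn: "n \<in> lattice" "deck m n y \<in> V" "y \<in> W"
    using y by (auto simp: S_proj_eq_iff image_iff)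
  define N where "N = W \<inter> deck m n -` V"
  have "open N" unfolding N_def
    using continuous_deck[of UNIV m n] V(1) W(1) by (simp add: open_vimage open_Int)
  moreover have "y \<in> N" using mn by (simp add: N_def)
  moreover have "N \<subseteq> overlap c d"
    unfolding o N_def using S_proj_deck[OF mn(1)] by (auto simp: image_iff) metis
  moreover have "transition c d z = deck m n z" if "z \<in> N" for z
  proof -
    have z: "z \<in> W" "deck m n z \<in> V" using that by (auto simp: N_def)
    have "inv_into (S_proj ` W) (inv_into W S_proj) z = S_proj z"
      using z(1) W(2) by (intro inv_into_f_eq) (auto intro: inj_on_inv_into)
    then have "transition c d z = inv_into V S_proj (S_proj (deck m n z))"
      by (simp add: transition_def c d S_proj_deck[OF mn(1)])
    then show ?thesis using V(2) z(2) by simp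
  qed
  ultimately show ?thesis using that mn(1) by blast
qed

lemma transition_S:
  assumes c: "c \<in> S_atlas" and d: "d \<in> S_atlas"
  shows "open (overlap c d)" and "smooth_on (overlap c d) (transition c d)"
    and "y \<in> overlap c d \<Longrightarrow> \<exists>m. frechet_derivative (transition c d) (at y) = deck_lin m"
proof -
  have L: "\<exists>N m n. open N \<and> y \<in> N \<and> N \<subseteq> overlap c d \<and>
     (\<forall>z\<in>N. transition c d z = deck_lin m z + (n, of_int_vec m))"
    if y: "y \<in> overlap c d" for y
  proof -
    obtain W V where W: "open W" "inj_on S_proj W" "c = (S_proj ` W, inv_into W S_proj)"
      and V: "open V" "inj_on S_proj V" "d = (S_proj ` V, inv_into V S_proj)"
      using c d by (metis S_atlas_E)
    show ?thesis
      using transition_locally_deck[OF W(1,2) V(1,2) W(3) V(3) y] by (metis deck_affine)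
  qed
  show "open (overlap c d)"
    by (subst open_subopen) (use L in blast)
  show "smooth_on (overlap c d) (transition c d)"
    unfolding smooth_on_def
    by (intro allI Ck_on_locally_affine) (use L bounded_linear_deck_lin in meson)
  show "\<exists>m. frechet_derivative (transition c d) (at y) = deck_lin m" if "y \<in> overlap c d"
    using L[OF that] has_derivative_frechet(2)[OF bounded_linear_deck_lin] by metis
qed

lemma of_int_vec_less_1: assumes "norm (of_int_vec a - of_int_vec b) < 1" shows "a = b"
proof -
  have "\<bar>real_of_int (a $ i - b $ i)\<bar> < 1" for i
    using component_le_norm_cart[of "of_int_vec a - of_int_vec b" i] assms
    by (simp add: of_int_vec_def)
  then have "\<bar>a $ i - b $ i\<bar> < 1" for i
    by (simp only: of_int_abs[symmetric] of_int_less_1_iff)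
  then have "a $ i = b $ i" for i by (smt (verit))
  then show ?thesis by (simp add: vec_eq_iff)
qed

lemma lattice_less_1: assumes "n \<in> lattice" "norm n < 1" shows "n = 0"
proof -
  have "n $ i = 0" for i
    using component_le_norm_cart[of n i] assms Ints_nonzero_abs_less1[of "n $ i"]
    by (auto simp: lattice_def)
  then show ?thesis by (simp add: vec_eq_iff)
qed

lemma norm_fst_le': "norm (fst p) \<le> norm p" and norm_snd_le': "norm (snd p) \<le> norm p"
  by (cases p; simp add: norm_Pair real_le_rsqrt)+

lemma inj_S_proj_ball: "inj_on S_proj (ball y (1/2))"
proof (rule inj_onI)
  fix a b assume a: "a \<in> ball y (1/2)" and b: "b \<in> ball y (1/2)" and "S_proj a = S_proj b"
  then obtain m n where n: "n \<in> lattice" "b = deck m n a" by (auto simp: S_proj_eq_iff)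
  have ba: "norm (b - a) < 1"
    using a b dist_triangle_half_r[of y b 1 a] by (simp add: dist_norm)
  have "norm (snd (b - a)) < 1" by (rule le_less_trans[OF norm_snd_le' ba])
  then have m0: "m = 0" using of_int_vec_less_1[of m 0]
    by (cases a) (simp add: n(2) deck_def of_int_vec_simps)
  have "norm (fst (b - a)) < 1" by (rule le_less_trans[OF norm_fst_le' ba])
  then have "n = 0"
    using lattice_less_1[OF n(1)] by (cases a) (simp add: n(2) deck_def m0 A_pow_0)
  then show "a = b" by (cases a) (simp add: n(2) deck_def m0 A_pow_0 of_int_vec_simps)
qed

lemma S_chart_at:
  obtains W where "open W" "y \<in> W" "inj_on S_proj W" "(S_proj ` W, inv_into W S_proj) \<in> S_atlas"
  using inj_S_proj_ball[of y] that[of "ball y (1/2)"] by (auto simp: suspension_S_def)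

lemma carrier_S_atlas: "\<Union>(fst ` S_atlas) = S_carrier"
proof -
  have "S_proj y \<in> \<Union>(fst ` S_atlas)" for y
    using S_chart_at[of y] by (metis UN_I fst_conv image_eqI)
  then show ?thesis by (auto simp: S_carrier_conv suspension_S_def)
qed

lemma openin_atlas_topology:
  assumes inj: "\<And>c. c \<in> A \<Longrightarrow> inj_on (snd c) (fst c)"
  shows "openin (atlas_topology A) W \<longleftrightarrow>
     W \<subseteq> \<Union>(fst ` A) \<and> (\<forall>c\<in>A. open (snd c ` (fst c \<inter> W)))"
proof -
  have "istopology (\<lambda>W. W \<subseteq> \<Union>(fst ` A) \<and> (\<forall>c\<in>A. open (snd c ` (fst c \<inter> W))))"
    unfolding istopology_def
  proof (intro conjI allI impI; (elim conjE)?)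
    fix S T assume S: "S \<subseteq> \<Union>(fst ` A)" "\<forall>c\<in>A. open (snd c ` (fst c \<inter> S))"
      and T: "\<forall>c\<in>A. open (snd c ` (fst c \<inter> T))"
    show "S \<inter> T \<subseteq> \<Union>(fst ` A)" using S by blast
    have "snd c ` (fst c \<inter> (S \<inter> T)) = snd c ` (fst c \<inter> S) \<inter> snd c ` (fst c \<inter> T)"
      if "c \<in> A" for c
      using inj_on_image_Int[OF inj[OF that], of "fst c \<inter> S" "fst c \<inter> T"]
      by (simp add: Int_ac)
    then show "\<forall>c\<in>A. open (snd c ` (fst c \<inter> (S \<inter> T)))" using S T by (simp add: open_Int)
  next
    fix K assume K: "\<forall>S\<in>K. S \<subseteq> \<Union>(fst ` A) \<and> (\<forall>c\<in>A. open (snd c ` (fst c \<inter> S)))"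
    show "\<Union>K \<subseteq> \<Union>(fst ` A)" using K by blast
    show "\<forall>c\<in>A. open (snd c ` (fst c \<inter> \<Union>K))"
    proof
      fix c assume c: "c \<in> A"
      have "snd c ` (fst c \<inter> \<Union>K) = (\<Union>S\<in>K. snd c ` (fst c \<inter> S))" by blast
      then show "open (snd c ` (fst c \<inter> \<Union>K))" using K c by (simp add: open_UN)
    qed
  qed
  then show ?thesis unfolding atlas_topology_def by (simp add: topology_inverse')
qed

lemma S_atlas_inj: "c \<in> S_atlas \<Longrightarrow> inj_on (snd c) (fst c)"
  by (erule S_atlas_E) (simp add: inj_on_inv_into)

lemmas openin_S = openin_atlas_topology[of S_atlas, OF S_atlas_inj]

lemma openin_S_proj: "open O' \<Longrightarrow> openin (atlas_topology S_atlas) (S_proj ` O')"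
proof -
  assume o: "open O'"
  have "open (snd c ` (fst c \<inter> S_proj ` O'))" if cA: "c \<in> S_atlas" for c
  proof -
    obtain W where W: "open W" "inj_on S_proj W" "c = (S_proj ` W, inv_into W S_proj)"
      using S_atlas_E[OF cA] by blast
    have "snd c ` (fst c \<inter> S_proj ` O') = W \<inter> {y. S_proj y \<in> S_proj ` O'}"
      by (auto simp: W(3) chart_image_S[OF W(2)])
    then show ?thesis using W(1) open_saturation[OF o] by (simp add: open_Int)
  qed
  then show ?thesis by (auto simp: openin_S carrier_S_atlas S_carrier_conv)
qed

lemma topspace_S: "topspace (atlas_topology S_atlas) = S_carrier"
proof
  show "topspace (atlas_topology S_atlas) \<subseteq> S_carrier"
    using openin_topspace[of "atlas_topology S_atlas"] openin_S[of "topspace (atlas_topology S_atlas)"]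
    by (simp add: carrier_S_atlas)
  show "S_carrier \<subseteq> topspace (atlas_topology S_atlas)"
    using openin_subset[OF openin_S_proj[OF open_UNIV]] by (simp add: S_carrier_conv)
qed

lemma closed_lattice: "closed (lattice :: (real^'n) set)"
proof -
  have *: "(lattice :: (real^'n) set) = (\<Inter>i. (\<lambda>v. v $ i) -` \<int>)"
    by (auto simp: lattice_def)
  show ?thesis
    unfolding * by (intro closed_INT ballI closed_vimage closed_Ints continuous_intros)
qed

lemma S_separation:
  assumes "S_proj y \<noteq> S_proj z"
  obtains U V where "open U" "open V" "y \<in> U" "z \<in> V" "S_proj ` U \<inter> S_proj ` V = {}"
proof -
  define B where "B = ball y (1/4) \<times> ball z (1/4)"
  define E where "E m = {p. \<exists>n\<in>lattice. snd p = deck m n (fst p)}" for m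
  have yzE: "(y, z) \<notin> E m" for m using assms by (auto simp: E_def S_proj_eq_iff)
  have closedE: "closed (E m)" for m
  proof -
    have "E m = {p. snd (fst p) + of_int_vec m = snd (snd p)} \<inter>
        (\<lambda>p. fst (snd p) - A_pow (m $ 1) (fst (fst p))) -` lattice"
    proof (intro set_eqI)
      fix p :: "((real^8) \<times> (real^4)) \<times> ((real^8) \<times> (real^4))"
      obtain v x w u where p: "p = ((v, x), (w, u))" by (metis surj_pair)
      show "p \<in> E m \<longleftrightarrow> p \<in> {p. snd (fst p) + of_int_vec m = snd (snd p)} \<inter>
        (\<lambda>p. fst (snd p) - A_pow (m $ 1) (fst (fst p))) -` lattice"
        unfolding p E_def deck_def
        by (auto intro: bexI[of _ "w - A_pow (m $ 1) v"])
    qed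
    moreover have "continuous_on UNIV
       (\<lambda>p::((real^8) \<times> (real^4)) \<times> ((real^8) \<times> (real^4)). fst (snd p) - A_pow (m $ 1) (fst (fst p)))"
      by (intro continuous_intros linear_continuous_on_compose[OF _ linear_A_pow])
    ultimately show ?thesis
      using closed_lattice
      by (auto intro!: closed_Int closed_vimage closed_Collect_eq continuous_intros)
  qed
  have "\<exists>m. B \<inter> (\<Union>k. E k) \<subseteq> E m"
  proof -
    have uniq: "a = b" if a: "p \<in> B" "p \<in> E a" and b: "q \<in> B" "q \<in> E b" for p q a b
    proof -
      have e: "of_int_vec a = snd (snd p) - snd (fst p)" "of_int_vec b = snd (snd q) - snd (fst q)"
        using a b by (auto simp: E_def deck_def case_prod_unfold)
      have "fst p \<in> ball y (1/4)" "fst q \<in> ball y (1/4)" "snd p \<in> ball z (1/4)" "snd q \<in> ball z (1/4)"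
        using a b by (auto simp: B_def mem_Times_iff)
      then have "dist (fst p) (fst q) < 1/2" "dist (snd p) (snd q) < 1/2"
        using dist_triangle_half_r[of y _ "1/2"] dist_triangle_half_r[of z _ "1/2"] by auto
      then have "dist (snd (fst p)) (snd (fst q)) < 1/2" "dist (snd (snd p)) (snd (snd q)) < 1/2"
        using dist_snd_le[of "fst p" "fst q"] dist_snd_le[of "snd p" "snd q"] by simp_all
      then have "norm (of_int_vec a - of_int_vec b) < 1"
        unfolding e dist_norm
        using norm_triangle_ineq4[of "snd (snd p) - snd (snd q)" "snd (fst p) - snd (fst q)"]
        by (simp add: algebra_simps)
      then show "a = b" by (rule of_int_vec_less_1)
    qed
    show ?thesis
    proof (cases "B \<inter> (\<Union>k. E k) = {}")
      case False
      then obtain p m where "p \<in> B" "p \<in> E m" by blast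
      then show ?thesis using uniq by blast
    qed auto
  qed
  then obtain m where m: "B \<inter> (\<Union>k. E k) \<subseteq> E m" by blast
  have "open (B - E m)" using closedE by (auto simp: B_def intro!: open_Diff open_Times)
  moreover have "(y, z) \<in> B - E m" using yzE by (simp add: B_def)
  ultimately obtain U V where "open U" "open V" "(y, z) \<in> U \<times> V" "U \<times> V \<subseteq> B - E m"
    by (rule open_prod_elim)
  then have UV: "open U" "open V" "y \<in> U" "z \<in> V" "U \<times> V \<subseteq> B - E m" by auto
  have "S_proj ` U \<inter> S_proj ` V = {}"
  proof (rule ccontr)
    assume "S_proj ` U \<inter> S_proj ` V \<noteq> {}"
    then obtain a b where ab: "a \<in> U" "b \<in> V" "S_proj a = S_proj b" by auto
    then obtain k n where "n \<in> lattice" "b = deck k n a" by (auto simp: S_proj_eq_iff)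
    then have "(a, b) \<in> E k" by (auto simp: E_def)
    moreover have "(a, b) \<in> B - E m" using ab UV(5) by auto
    ultimately show False using m by auto
  qed
  then show ?thesis using that UV by blast
qed

lemma Hausdorff_S: "Hausdorff_space (atlas_topology S_atlas)"
  unfolding Hausdorff_space_def topspace_S S_carrier_conv
proof (intro allI impI; elim conjE imageE)
  fix p q y z assume pq: "p \<noteq> q" "p = S_proj y" "q = S_proj z"
  then obtain U V where "open U" "open V" "y \<in> U" "z \<in> V" "S_proj ` U \<inter> S_proj ` V = {}"
    using S_separation[of y z] by metis
  then show "\<exists>U V. openin (atlas_topology S_atlas) U \<and> openin (atlas_topology S_atlas) V \<and>
      p \<in> U \<and> q \<in> V \<and> disjnt U V"
    by (intro exI[of _ "S_proj ` U"] exI[of _ "S_proj ` V"])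
       (simp add: openin_S_proj pq disjnt_def)
qed

lemma second_countable_S: "second_countable (atlas_topology S_atlas)"
proof -
  obtain \<B> :: "((real^8) \<times> (real^4)) set set"
    where B: "countable \<B>" "topological_basis \<B>" using ex_countable_basis by blast
  show ?thesis unfolding second_countable_def
  proof (intro exI[of _ "(`) S_proj ` \<B>"] conjI ballI allI impI)
    show "countable ((`) S_proj ` \<B>)" using B(1) by simp
    show "openin (atlas_topology S_atlas) V" if "V \<in> (`) S_proj ` \<B>" for V
      using that openin_S_proj topological_basis_open[OF B(2)] by auto
    fix U p assume Up: "openin (atlas_topology S_atlas) U \<and> p \<in> U"
    then obtain y where y: "p = S_proj y"
      using openin_subset[of "atlas_topology S_atlas" U] by (auto simp: topspace_S S_carrier_conv)
    obtain W where W: "open W" "y \<in> W" "inj_on S_proj W"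
      "(S_proj ` W, inv_into W S_proj) \<in> S_atlas" by (rule S_chart_at)
    then have "open {y\<in>W. S_proj y \<in> U}"
      using Up chart_image_S[OF W(3), of U] by (force simp: openin_S)
    moreover have "y \<in> {y\<in>W. S_proj y \<in> U}" using W Up y by simp
    ultimately obtain N where N: "N \<in> \<B>" "y \<in> N" "N \<subseteq> {y\<in>W. S_proj y \<in> U}"
      by (rule topological_basisE[OF B(2)])
    then show "\<exists>V\<in>(`) S_proj ` \<B>. p \<in> V \<and> V \<subseteq> U"
      using y by (intro bexI[of _ "S_proj ` N"]) auto
  qed
qed

lemma smooth_atlas_S: "smooth_atlas S_atlas"
proof -
  have "open (chart_image c)" if "c \<in> S_atlas" for c
    using transition_S(1)[OF that that] by (simp add: overlap_def chart_image_def)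
  then show ?thesis
    unfolding smooth_atlas_def using S_atlas_inj transition_S Hausdorff_S second_countable_S by blast
qed

lemma complex_structure_S:
  assumes "linear T" "\<And>v. T (T v) = - v" "\<And>m v. deck_lin m (T v) = T (deck_lin m v)"
  shows "complex_structure S_atlas (\<lambda>c p. T)"
proof -
  have "open (chart_image c)" if "c \<in> S_atlas" for c
    using smooth_atlas_S that by (auto simp: smooth_atlas_def)
  moreover have "frechet_derivative (transition c d) (at x) (T v) =
       T (frechet_derivative (transition c d) (at x) v)"
    if "c \<in> S_atlas" "d \<in> S_atlas" "x \<in> overlap c d" for c d x v
    using transition_S(3)[OF that] assms(3) by metis
  moreover have "nijenhuis (\<lambda>p. T) x v w = 0" for x v w
    using linear_0[OF assms(1)] by (simp add: nijenhuis_def)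
  ultimately show ?thesis
    unfolding complex_structure_def smooth_endo_field_def
    using assms(1,2) by (auto simp: smooth_on_const)
qed

theorem hypercomplex_manifold_S: "hypercomplex_manifold suspension_S"
proof -
  have lin: "linear (\<lambda>(v, x). (T v, U x))" if "linear T" "linear U"
    for T :: "real^8 \<Rightarrow> real^8" and U :: "real^4 \<Rightarrow> real^4"
    using that by (auto simp: linear_iff)
  have c: "complex_structure S_atlas (\<lambda>c p. \<lambda>(v, x). (I8 v, I4 x))"
     "complex_structure S_atlas (\<lambda>c p. \<lambda>(v, x). (J8 v, J4 x))"
     "complex_structure S_atlas (\<lambda>c p. \<lambda>(v, x). (I8 (J8 v), I4 (J4 x)))"
    using linear_IJ linear_compose[OF linear_IJ(2,1)] linear_compose[OF linear_IJ(4,3)]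
    by (auto intro!: complex_structure_S lin
        simp: IJ8_relations IJ4_relations deck_lin_def A_pow_I8 A_pow_J8 o_def linear_neg)
  then show ?thesis
    unfolding hypercomplex_manifold_def
    using smooth_atlas_S c by (auto simp: suspension_S_def IJ8_relations IJ4_relations)
qed

end

theory Submission
  imports Defs
begin

text \<open>
  The matrix \<open>A\<close> satisfies \<open>A\<^sup>4 + 6 A\<^sup>2 + 1 = 0\<close>, so it splits \<open>\<real>\<^sup>8\<close> into two
  \<open>A\<close>-invariant quaternionic lines, on which it is conformal with the factors \<open>1 + \<surd>2\<close> and \<open>\<surd>2 - 1\<close>.

  Pull back the Euclidean metrics of these lines to \<open>\<real>\<^sup>8\<close> and rescale them by reciprocal exponentials
  of \<open>x\<^sub>1\<close> that compensate these factors. With the flat metric of \<open>\<real>\<^sup>4\<close> this gives a metric on the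
  suspension with \<open>\<Omega> = f \<omega>\<^sub>1 + f\<inverse> \<omega>\<^sub>2 + \<omega>\<^sub>3\<close>, where the \<open>\<omega>\<^sub>i\<close> are constant and decomposable. In
  \<open>\<Omega>\<^sup>2\<close> the only nonconstant coefficients belong to \<open>\<omega>\<^sub>i \<and> \<omega>\<^sub>3\<close>, and \<open>\<partial> f\<close> is a multiple of a
  factor of \<open>\<omega>\<^sub>3\<close>, so \<open>\<partial>(\<Omega>\<^sup>2) = 0\<close>.

  For an HKT metric, \<open>\<partial>\<Omega> = 0\<close> makes the \<open>x\<^sub>1\<close>-derivative of the squared length of a constant vector
  \<open>u\<close> of \<open>\<real>\<^sup>8\<close> a divergence in the torus directions. Hence its mean over the torus, computed over large
  balls in \<open>\<real>\<^sup>8\<close>, is independent of \<open>x\<^sub>1\<close>. But moving by \<open>- n\<close> in \<open>x\<^sub>1\<close> replaces \<open>u\<close> by \<open>A\<^sup>n u\<close>, whose length grows exponentially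
  uniformly on the compact torus.
\<close>

section \<open>The operator \<open>\<partial>\<close> on forms of type \<open>(k, 0)\<close>\<close>

definition apply_slots :: "('e \<Rightarrow> 'e) \<Rightarrow> nat set \<Rightarrow> (nat \<Rightarrow> 'e) \<Rightarrow> nat \<Rightarrow> 'e" where
  "apply_slots T R v = (\<lambda>j. if j \<in> R then T (v j) else v j)"

text \<open>The argument tuple of the i-th summand of \<open>ext_deriv\<close>, with slot i left
  out.\<close>

definition face :: "nat \<Rightarrow> (nat \<Rightarrow> 'e) \<Rightarrow> nat \<Rightarrow> 'e" where
  "face i v = (\<lambda>j. if j < i then v j else v (Suc j))"

lemma apply_slots_insert:
  "i \<notin> R \<Longrightarrow> apply_slots T (insert i R) v = apply_slots T R (v(i := T (v i)))"
  by (auto simp: apply_slots_def)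

text \<open>The hypothesis is complex linearity in the slots of \<open>R\<close>; a form of type (k,
  0) satisfies it in every slot.\<close>

lemma apply_slots_eigen:
  fixes \<phi> :: "(nat \<Rightarrow> 'e) \<Rightarrow> complex"
  assumes "finite R" and "\<And>v j. j \<in> R \<Longrightarrow> \<phi> (v(j := T (v j))) = \<i> * \<phi> v"
  shows "\<phi> (apply_slots T R v) = \<i> ^ card R * \<phi> v"
  using assms
proof (induction R arbitrary: v rule: finite_induct)
  case empty
  then show ?case by (simp add: apply_slots_def)
next
  case (insert i R)
  then show ?case by (simp add: apply_slots_insert del: fun_upd_apply)
qed

text \<open>By complex linearity the sum over \<open>R\<close> is the expanded product over all
  slots j of (1 + 1) / 2 for j in \<open>S\<close> and (1 - 1) / 2 otherwise. It vanishes unless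
  \<open>S\<close> consists of all k slots.\<close>

lemma type_component_top_form:
  assumes "\<And>v j. j < k \<Longrightarrow> \<alpha> (v(j := T (v j))) = \<i> * \<alpha> v"
  shows "type_component T k p \<alpha> v = (if p = k then \<alpha> v else 0)"
proof -
  have inner: "(\<Sum>R\<in>Pow {..<k}. (\<Prod>j\<in>R. if j \<in> S then - \<i> else \<i>) / 2 ^ k *
      \<alpha> (\<lambda>j. if j \<in> R then T (v j) else v j)) = (if S = {..<k} then \<alpha> v else 0)"
    if S: "S \<subseteq> {..<k}" for S
  proof -
    \<comment> \<open>The product of ones over the complement of \<open>R\<close> prepares for
      \<open>prod_add\<close>.\<close>
    have "(\<Sum>R\<in>Pow {..<k}. (\<Prod>j\<in>R. if j \<in> S then - \<i> else \<i>) / 2 ^ k *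
        \<alpha> (\<lambda>j. if j \<in> R then T (v j) else v j)) =
      (\<Sum>R\<in>Pow {..<k}. (\<Prod>j\<in>R. if j \<in> S then 1 else - 1) * (\<Prod>j\<in>{..<k} - R. 1)) * \<alpha> v / 2 ^ k"
      unfolding sum_distrib_right sum_divide_distrib
    proof (rule sum.cong[OF refl])
      fix R assume "R \<in> Pow {..<k}"
      then have R: "finite R" "\<And>j. j \<in> R \<Longrightarrow> j < k" by (auto intro: finite_subset)
      have e: "\<alpha> (\<lambda>j. if j \<in> R then T (v j) else v j) = \<i> ^ card R * \<alpha> v"
        using apply_slots_eigen[OF R(1), of \<alpha> T v] assms R(2) by (simp add: apply_slots_def)
      have "(\<Prod>j\<in>R. if j \<in> S then - \<i> else \<i>) * \<i> ^ card R =
          (\<Prod>j\<in>R. (if j \<in> S then - \<i> else \<i>) * \<i>)"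
        by (simp add: prod.distrib)
      also have "\<dots> = (\<Prod>j\<in>R. if j \<in> S then 1 else - 1)" by (rule prod.cong) auto
      finally have p: "(\<Prod>j\<in>R. if j \<in> S then - \<i> else \<i>) * \<i> ^ card R =
         (\<Prod>j\<in>R. if j \<in> S then 1 else - 1)" .
      show "(\<Prod>j\<in>R. if j \<in> S then - \<i> else \<i>) / 2 ^ k *
          \<alpha> (\<lambda>j. if j \<in> R then T (v j) else v j) =
        (\<Prod>j\<in>R. if j \<in> S then 1 else - 1) * (\<Prod>j\<in>{..<k} - R. 1) * \<alpha> v / 2 ^ k"
        unfolding e p[symmetric] by simp
    qed
    also have "\<dots> = (\<Prod>j<k. (if j \<in> S then 1 else - 1) + 1) * \<alpha> v / 2 ^ k"
      by (subst prod_add) simp_all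
    also have "(\<Prod>j<k. (if j \<in> S then 1 else - 1) + (1::complex)) =
        (if S = {..<k} then 2 ^ k else 0)"
    proof (cases "S = {..<k}")
      case True
      then have "(\<Prod>j<k. (if j \<in> S then 1 else - 1) + (1::complex)) = (\<Prod>j<k. 2)"
        by (intro prod.cong) auto
      then show ?thesis using True by simp
    next
      case False
      then obtain j where "j < k" "j \<notin> S" using S by auto
      then have "\<exists>j\<in>{..<k}. (if j \<in> S then 1 else - 1) + (1::complex) = 0" by (intro bexI[of _ j]) auto
      then show ?thesis using False by (simp add: prod_zero_iff)
    qed
    finally show ?thesis by simp
  qed
  have "type_component T k p \<alpha> v =
      (\<Sum>S | S \<subseteq> {..<k} \<and> card S = p. if S = {..<k} then \<alpha> v else 0)"
    unfolding type_component_def by (rule sum.cong) (use inner in auto)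
  also have "\<dots> = (if p = k then \<alpha> v else 0)"
    by (subst sum.delta) (auto intro: finite_subset[of _ "Pow {..<k}"])
  finally show ?thesis .
qed

text \<open>The weight -\<i> per slot cancels the eigenvalue \<i> on \<open>B\<close>, so a subset
  contributes only according to whether it contains i. What remains is the (1, 0)-combination in
  slot i.\<close>

lemma sum_apply_slots_eigen:
  fixes \<phi> :: "(nat \<Rightarrow> 'e) \<Rightarrow> complex"
  assumes fin: "finite B" and i: "i \<notin> B"
    and eig: "\<And>v j. j \<in> B \<Longrightarrow> \<phi> (v(j := T (v j))) = \<i> * \<phi> v"
  shows "(\<Sum>R\<in>Pow (insert i B). (- \<i>) ^ card R * \<phi> (apply_slots T R v)) =
    2 ^ card B * (\<phi> v - \<i> * \<phi> (v(i := T (v i))))"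
proof -
  have e: "(- \<i>) ^ card R * \<phi> (apply_slots T R w) = \<phi> w" if "R \<in> Pow B" for R w
  proof -
    have "\<phi> (apply_slots T R w) = \<i> ^ card R * \<phi> w"
      using that fin eig finite_subset[of R B]
      by (intro apply_slots_eigen) (auto simp del: fun_upd_apply)
    then show ?thesis by (simp flip: power_mult_distrib mult.assoc)
  qed
  have "(\<Sum>R\<in>Pow (insert i B). (- \<i>) ^ card R * \<phi> (apply_slots T R v)) =
      (\<Sum>R\<in>Pow B. (- \<i>) ^ card R * \<phi> (apply_slots T R v)) +
      (\<Sum>R\<in>insert i ` Pow B. (- \<i>) ^ card R * \<phi> (apply_slots T R v))"
    unfolding Pow_insert using fin i by (intro sum.union_disjoint) auto
  also have "(\<Sum>R\<in>insert i ` Pow B. (- \<i>) ^ card R * \<phi> (apply_slots T R v)) =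
      (\<Sum>R\<in>Pow B. (- \<i>) ^ card (insert i R) * \<phi> (apply_slots T (insert i R) v))"
    by (subst sum.reindex) (use i in \<open>auto simp: inj_on_def\<close>)
  also have "\<dots> = (\<Sum>R\<in>Pow B. - \<i> * \<phi> (v(i := T (v i))))"
  proof (rule sum.cong[OF refl])
    fix R assume R: "R \<in> Pow B"
    then have "i \<notin> R" "finite R" using i fin by (auto intro: finite_subset)
    then show "(- \<i>) ^ card (insert i R) * \<phi> (apply_slots T (insert i R) v) =
        - \<i> * \<phi> (v(i := T (v i)))"
      using e[OF R, of "v(i := T (v i))"] by (simp add: apply_slots_insert)
  qed
  also have "(\<Sum>R\<in>Pow B. (- \<i>) ^ card R * \<phi> (apply_slots T R v)) = (\<Sum>R\<in>Pow B. \<phi> v)"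
    by (rule sum.cong[OF refl e])
  finally show ?thesis using fin by (simp add: card_Pow algebra_simps del: fun_upd_apply)
qed

lemma face_upd:
  assumes "j \<noteq> i" and "j' = (if j < i then j else j - 1)"
  shows "face i (v(j := x)) = (face i v)(j' := x)" and "face i v j' = v j"
    and "j \<le> k \<Longrightarrow> i \<le> k \<Longrightarrow> j' < k"
  using assms by (auto simp: face_def fun_eq_iff)

lemma face_upd_same: "face i (v(i := x)) = face i v"
  by (auto simp: face_def fun_eq_iff)

text \<open>Of the types in \<open>del\<close> only p = k survives, and only the component (k + 1,
  0) of the exterior derivative is needed. In its i-th summand the form is complex linear in all
  slots but i, so the projection acts only on the direction of differentiation.\<close>

lemma del_top_form:
  fixes \<omega> :: "'e::euclidean_space form"
  assumes U: "open U" "x \<in> U"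
    and eig: "\<And>y v j. y \<in> U \<Longrightarrow> j < k \<Longrightarrow> \<omega> y (v(j := T (v j))) = \<i> * \<omega> y v"
    and diff: "\<And>v. (\<lambda>y. \<omega> y v) differentiable (at x)"
  shows "del (\<lambda>_. T) k \<omega> x v = (\<Sum>i\<le>k. (-1) ^ i *
     (frechet_derivative (\<lambda>y. \<omega> y (face i v)) (at x) (v i) -
      \<i> * frechet_derivative (\<lambda>y. \<omega> y (face i v)) (at x) (T (v i)))) / 2"
proof -
  define D where "D w = frechet_derivative (\<lambda>y. \<omega> y w) (at x)" for w
  have D: "((\<lambda>y. \<omega> y w) has_derivative D w) (at x)" for w
    unfolding D_def using diff frechet_derivative_works by blast
  have "frechet_derivative (\<lambda>y. type_component T k p (\<omega> y) w) (at x) =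
      (if p = k then D w else (\<lambda>_. 0))" for p w
  proof -
    have "((\<lambda>y. if p = k then \<omega> y w else 0) has_derivative (if p = k then D w else (\<lambda>_. 0))) (at x)"
      using D by auto
    then have "((\<lambda>y. type_component T k p (\<omega> y) w) has_derivative
        (if p = k then D w else (\<lambda>_. 0))) (at x)"
      by (rule has_derivative_transform_within_open[OF _ U]) (simp add: type_component_top_form[of k] eig del: fun_upd_apply)
    then show ?thesis by (rule frechet_derivative_at[symmetric])
  qed
  then have ext: "ext_deriv k (\<lambda>y. type_component T k p (\<omega> y)) x =
      (\<lambda>w. if p = k then \<Sum>i\<le>k. (-1) ^ i * D (face i w) (w i) else 0)" for p
    unfolding ext_deriv_def face_def[symmetric] by auto
  \<comment> \<open>The eigenvalue relation holds on the open set \<open>U\<close>, so it may be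
    differentiated at x.\<close>
  have Di: "D (w(j := T (w j))) z = \<i> * D w z" if "j < k" for w j z
  proof -
    have "((\<lambda>y. \<i> * \<omega> y w) has_derivative (\<lambda>z. \<i> * D w z)) (at x)"
      by (intro derivative_intros D)
    then have "((\<lambda>y. \<omega> y (w(j := T (w j)))) has_derivative (\<lambda>z. \<i> * D w z)) (at x)"
      by (rule has_derivative_transform_within_open[OF _ U]) (use eig that in auto)
    then show ?thesis using has_derivative_unique[OF D] by metis
  qed
  define \<phi> where "\<phi> i w = D (face i w) (w i)" for i w
  have \<phi>: "(\<Sum>R\<in>Pow {..k}. (- \<i>) ^ card R * \<phi> i (apply_slots T R v)) =
      2 ^ k * (\<phi> i v - \<i> * \<phi> i (v(i := T (v i))))" if "i \<le> k" for i
  proof -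
    have "\<phi> i (w(j := T (w j))) = \<i> * \<phi> i w" if j: "j \<in> {..k} - {i}" for w j
    proof -
      define j' where "j' = (if j < i then j else j - 1)"
      have "j' < k" using j \<open>i \<le> k\<close> by (auto simp: j'_def)
      then show ?thesis using Di[of j' "face i w"] j
        by (simp add: \<phi>_def face_upd[OF _ j'_def] fun_upd_other del: fun_upd_apply)
    qed
    then have "(\<Sum>R\<in>Pow (insert i ({..k} - {i})). (- \<i>) ^ card R * \<phi> i (apply_slots T R v)) =
      2 ^ card ({..k} - {i}) * (\<phi> i v - \<i> * \<phi> i (v(i := T (v i))))"
      by (intro sum_apply_slots_eigen) (auto simp del: fun_upd_apply)
    then show ?thesis using \<open>i \<le> k\<close> by (simp add: insert_absorb)
  qed
  have top: "{S. S \<subseteq> {..k} \<and> card S = Suc k} = {{..k}}"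
    using card_subset_eq[of "{..k}"] by auto
  have prod: "(\<Prod>j\<in>R. if j \<le> k then - \<i> else \<i>) = (- \<i>) ^ card R" if "R \<subseteq> {..k}" for R
  proof -
    have "(\<Prod>j\<in>R. if j \<le> k then - \<i> else \<i>) = (\<Prod>j\<in>R. - \<i>)"
      by (rule prod.cong) (use that in auto)
    then show ?thesis by simp
  qed
  have "del (\<lambda>_. T) k \<omega> x v =
      (\<Sum>p\<le>k. if p = k then type_component T (Suc k) (Suc p) (\<lambda>w. \<Sum>i\<le>k. (-1) ^ i * \<phi> i w) v else 0)"
    unfolding del_def ext \<phi>_def by (rule sum.cong) (auto simp: type_component_def)
  also have "\<dots> = type_component T (Suc k) (Suc k) (\<lambda>w. \<Sum>i\<le>k. (-1) ^ i * \<phi> i w) v"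
    by simp
  also have "\<dots> = (\<Sum>R\<in>Pow {..k}. (- \<i>) ^ card R / 2 ^ Suc k *
      (\<Sum>i\<le>k. (-1) ^ i * \<phi> i (apply_slots T R v)))"
    by (simp add: type_component_def lessThan_Suc_atMost top prod apply_slots_def)
  also have "\<dots> = (\<Sum>i\<le>k. (-1) ^ i * (\<Sum>R\<in>Pow {..k}. (- \<i>) ^ card R * \<phi> i (apply_slots T R v))) / 2 ^ Suc k"
    unfolding sum_distrib_left sum_divide_distrib by (subst sum.swap) (simp add: mult_ac)
  also have "\<dots> = (\<Sum>i\<le>k. (-1) ^ i * (2 ^ k * (\<phi> i v - \<i> * \<phi> i (v(i := T (v i)))))) / 2 ^ Suc k"
    by (simp add: \<phi>)
  also have "\<dots> = (\<Sum>i\<le>k. (-1) ^ i * (\<phi> i v - \<i> * \<phi> i (v(i := T (v i))))) / 2"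
    by (simp add: sum_divide_distrib)
  finally show ?thesis by (simp add: \<phi>_def face_upd_same D_def)
qed

section \<open>Conservation laws with bounded fluxes\<close>

text \<open>The integral of the translate of h by s u does not depend on small s; differentiation
  under the integral at s = 0 gives the claim.\<close>

lemma integral_directional_derivative_compact_support:
  fixes h h' :: "'a::euclidean_space \<Rightarrow> real"
  assumes der: "\<And>v. ((\<lambda>s. h (v + s *\<^sub>R u)) has_real_derivative h' v) (at 0)"
    and cont: "continuous_on UNIV h" "continuous_on UNIV h'"
    and supp: "\<And>v. v \<notin> cbox a b \<Longrightarrow> h v = 0"
  shows "integral (cbox a b) h' = 0"
proof -
  \<comment> \<open>A box containing the two extreme translates of \<open>cbox a b\<close> contains,
    by convexity, all translates by s u with |s| < 1.\<close>
  obtain N where N: "cbox a b \<union> (\<lambda>v. v - u) ` cbox a b \<union> (\<lambda>v. v + u) ` cbox a b \<subseteq> cbox (- N) N"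
  proof -
    have "bounded (cbox a b \<union> (\<lambda>v. v - u) ` cbox a b \<union> (\<lambda>v. v + u) ` cbox a b)"
      by (auto intro!: compact_imp_bounded compact_continuous_image continuous_intros)
    then show ?thesis using that bounded_subset_cbox_symmetric by blast
  qed
  define B where "B = cbox (- N) N"
  have der_s: "((\<lambda>s. h (v + s *\<^sub>R u)) has_real_derivative h' (v + s *\<^sub>R u)) (at s)" for v s
  proof -
    have "((\<lambda>r. h ((v + s *\<^sub>R u) + r *\<^sub>R u)) has_real_derivative h' (v + s *\<^sub>R u)) (at 0)"
      by (rule der)
    then show ?thesis using DERIV_shift[of "\<lambda>s. h (v + s *\<^sub>R u)" "h' (v + s *\<^sub>R u)" 0 s] by (simp add: algebra_simps)
  qed
  have h'0: "h' v = 0" if "v \<notin> cbox a b" for v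
  proof -
    have "\<forall>\<^sub>F s in at 0. v + s *\<^sub>R u \<in> - cbox a b"
      by (rule topological_tendstoD[of _ v]) (use that in \<open>auto intro!: tendsto_eq_intros\<close>)
    then have "\<forall>\<^sub>F s in nhds 0. h (v + s *\<^sub>R u) = 0"
      using supp that by (auto simp: eventually_at_filter elim!: eventually_mono)
    then have "((\<lambda>s. h (v + s *\<^sub>R u)) has_real_derivative 0) (at 0)"
      by (subst DERIV_cong_ev[where g = "\<lambda>_. 0"]) auto
    then show ?thesis using der[of v] DERIV_unique by blast
  qed
  define H where "H s = integral B (\<lambda>v. h (v + s *\<^sub>R u))" for s :: real
  have "(H has_real_derivative integral B (\<lambda>v. h' (v + 0 *\<^sub>R u))) (at 0 within {-1<..<1})"
    unfolding H_def B_def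
  proof (rule leibniz_rule_field_derivative)
    show "((\<lambda>s. h (v + s *\<^sub>R u)) has_real_derivative h' (v + s *\<^sub>R u)) (at s within {-1<..<1})" for v s
      using der_s has_field_derivative_at_within by blast
    show "(\<lambda>v. h (v + s *\<^sub>R u)) integrable_on cbox (- N) N" for s
      by (intro integrable_continuous continuous_on_compose2[OF cont(1)] continuous_intros) auto
    show "continuous_on ({-1<..<1} \<times> cbox (- N) N) (\<lambda>(s, v). h' (v + s *\<^sub>R u))"
      unfolding case_prod_unfold
      by (intro continuous_on_compose2[OF cont(2)] continuous_intros) auto
  qed auto
  then have dH: "(H has_real_derivative integral B h') (at 0)"
    by (simp add: at_within_open[of 0 "{-1<..<1::real}"])
  have "H s = integral (cbox a b) h" if s: "s \<in> {-1<..<1}" for s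
  proof -
    have "(h has_integral integral (cbox a b) h) (cbox a b)"
      by (intro integrable_integral integrable_continuous continuous_on_subset[OF cont(1)]) auto
    then have "((\<lambda>v. h (v + s *\<^sub>R u)) has_integral integral (cbox a b) h) (cbox (a - s *\<^sub>R u) (b - s *\<^sub>R u))"
      by (rule has_integral_shift_cbox)
    moreover have "h (v + s *\<^sub>R u) = 0" if "v \<notin> cbox (a - s *\<^sub>R u) (b - s *\<^sub>R u)" for v
      using that by (intro supp) (auto simp: mem_box algebra_simps)
    moreover have "cbox (a - s *\<^sub>R u) (b - s *\<^sub>R u) \<subseteq> B"
    proof
      fix v assume v: "v \<in> cbox (a - s *\<^sub>R u) (b - s *\<^sub>R u)"
      define w where "w = v + s *\<^sub>R u"
      have "w \<in> cbox a b" using v by (auto simp: w_def mem_box algebra_simps)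
      then have "w - u \<in> B" "w + u \<in> B" using N by (auto simp: B_def)
      then have "((1 + s) / 2) *\<^sub>R (w - u) + ((1 - s) / 2) *\<^sub>R (w + u) \<in> B"
        unfolding B_def using s by (intro convexD[OF convex_box(1)]) (auto simp: field_simps)
      also have "((1 + s) / 2) *\<^sub>R (w - u) + ((1 - s) / 2) *\<^sub>R (w + u) = v"
        by (rule euclidean_eqI) (simp add: w_def inner_simps field_simps) 
      finally show "v \<in> B" .
    qed
    ultimately have "((\<lambda>v. h (v + s *\<^sub>R u)) has_integral integral (cbox a b) h) B"
      by (rule has_integral_on_superset)
    then show ?thesis by (simp add: H_def integral_unique)
  qed
  then have "\<forall>\<^sub>F s in nhds 0. H s = integral (cbox a b) h"
    using eventually_nhds_in_open[of "{-1<..<1::real}" 0] by (auto elim!: eventually_mono)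
  then have "(H has_real_derivative 0) (at 0)"
    by (subst DERIV_cong_ev[where g = "\<lambda>_. integral (cbox a b) h"]) auto
  then have "integral B h' = 0" using dH DERIV_unique by blast
  moreover have "integral B h' = integral (cbox a b) h'"
  proof -
    have "(h' has_integral integral (cbox a b) h') (cbox a b)"
      by (intro integrable_integral integrable_continuous continuous_on_subset[OF cont(2)]) auto
    then have "(h' has_integral integral (cbox a b) h') B"
      by (rule has_integral_on_superset) (use h'0 N in \<open>auto simp: B_def\<close>)
    then show ?thesis by (rule integral_unique)
  qed
  ultimately show ?thesis by simp
qed

section \<open>Cutoff functions\<close>

text \<open>Squaring the truncated quadratic makes it continuously differentiable across the sphere
  of radius R. It is of order R^4 on the ball of radius R / 2, whereas its directional derivative
  \<open>cutoff'\<close> is only of order R^3.\<close>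

definition cutoff :: "real \<Rightarrow> 'a::euclidean_space \<Rightarrow> real" where
  "cutoff R v = (max 0 (R\<^sup>2 - v \<bullet> v))\<^sup>2"

definition cutoff' :: "real \<Rightarrow> 'a::euclidean_space \<Rightarrow> 'a \<Rightarrow> real" where
  "cutoff' R u v = - 4 * max 0 (R\<^sup>2 - v \<bullet> v) * (v \<bullet> u)"

lemma has_real_derivative_max0_square:
  "((\<lambda>x::real. (max 0 x)\<^sup>2) has_real_derivative 2 * max 0 x) (at x)"
proof (cases x "0::real" rule: linorder_cases)
  case less
  have "((\<lambda>x::real. 0) has_real_derivative 2 * max 0 x) (at x)" using less by simp
  then show ?thesis
    by (rule has_field_derivative_transform_within_open[of _ _ _ "{..<0}"]) (use less in auto)
next
  case greater
  have "((\<lambda>x::real. x\<^sup>2) has_real_derivative 2 * max 0 x) (at x)"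
    using greater by (auto intro!: derivative_eq_intros)
  then show ?thesis
    by (rule has_field_derivative_transform_within_open[of _ _ _ "{0<..}"]) (use greater in auto)
next
  case equal
  have "((\<lambda>h::real. (max 0 h)\<^sup>2 / h) \<longlongrightarrow> 0) (at 0)"
  proof (rule Lim_null_comparison)
    show "\<forall>\<^sub>F h in at 0. norm ((max 0 h)\<^sup>2 / h) \<le> \<bar>h\<bar>"
      by (rule eventuallyI) (auto simp: max_def power2_eq_square)
    show "((\<lambda>h::real. \<bar>h\<bar>) \<longlongrightarrow> 0) (at 0)" by (auto intro!: tendsto_eq_intros)
  qed
  then show ?thesis by (simp add: equal DERIV_def)
qed

lemma has_real_derivative_cutoff:
  "((\<lambda>s. cutoff R (v + s *\<^sub>R u)) has_real_derivative cutoff' R u v) (at 0)"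
proof -
  have "((\<lambda>s. R\<^sup>2 - (v + s *\<^sub>R u) \<bullet> (v + s *\<^sub>R u)) has_real_derivative - 2 * (v \<bullet> u)) (at 0)"
    by (auto intro!: derivative_eq_intros simp: inner_simps inner_commute algebra_simps)
  from DERIV_chain2[OF has_real_derivative_max0_square this]
  show ?thesis by (simp add: cutoff_def cutoff'_def algebra_simps)
qed

lemma continuous_on_cutoff: "continuous_on X (cutoff R)" "continuous_on X (cutoff' R u)"
  unfolding cutoff_def[abs_def] cutoff'_def[abs_def] by (intro continuous_intros)+

lemma cutoff_nonneg: "0 \<le> cutoff R v"
  by (simp add: cutoff_def)

lemma cutoff_eq_0: "0 \<le> R \<Longrightarrow> R \<le> norm v \<Longrightarrow> cutoff R v = 0"
  by (simp add: cutoff_def max_def power_mono flip: power2_norm_eq_inner)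

lemma cutoff_ge: "0 \<le> R \<Longrightarrow> norm v \<le> R / 2 \<Longrightarrow> R ^ 4 / 4 \<le> cutoff R v"
proof -
  assume R: "0 \<le> R" "norm v \<le> R / 2"
  then have "(norm v)\<^sup>2 \<le> (R / 2)\<^sup>2" by (intro power_mono) auto
  then have "v \<bullet> v \<le> R\<^sup>2 / 4" by (simp add: power_divide flip: power2_norm_eq_inner)
  then have "R\<^sup>2 / 2 \<le> R\<^sup>2 - v \<bullet> v" using zero_le_power2[of R] by linarith
  then have "R\<^sup>2 / 2 \<le> max 0 (R\<^sup>2 - v \<bullet> v)" by (rule order_trans) simp
  then have "(R\<^sup>2 / 2)\<^sup>2 \<le> cutoff R v" unfolding cutoff_def by (intro power_mono) auto
  then show ?thesis by (simp add: power_divide flip: power_mult)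
qed

lemma abs_cutoff'_le: assumes "0 \<le> R" shows "\<bar>cutoff' R u v\<bar> \<le> 4 * R ^ 3 * norm u"
proof (cases "norm v \<le> R")
  case True
  have "max 0 (R\<^sup>2 - v \<bullet> v) * \<bar>v \<bullet> u\<bar> \<le> R\<^sup>2 * (R * norm u)"
    using True assms by (intro mult_mono order_trans[OF Cauchy_Schwarz_ineq2] mult_right_mono) auto
  then show ?thesis by (simp add: cutoff'_def abs_mult power3_eq_cube power2_eq_square)
next
  case False
  then have "R\<^sup>2 - v \<bullet> v \<le> 0" using assms by (simp add: power_mono flip: power2_norm_eq_inner)
  then show ?thesis using assms by (simp add: cutoff'_def max_def)
qed

lemma integral_cutoff_ge:
  assumes "0 \<le> R"
  shows "R ^ 4 / 4 * (R / DIM('a)) ^ DIM('a) \<le> integral (cbox (- (R *\<^sub>R One)) (R *\<^sub>R One))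
      (cutoff R :: 'a::euclidean_space \<Rightarrow> real)"
proof -
  \<comment> \<open>By \<open>norm_le_l1\<close> the cube of half side r lies in the ball of radius
    R / 2, where \<open>cutoff_ge\<close> applies; its volume is (R / d)^d with d the
    dimension.\<close>
  define r where "r = R / (2 * DIM('a))"
  have r: "0 \<le> r" "r \<le> R" using assms mult_left_mono[of 1 "real DIM('a) * 2" R] DIM_positive[where 'a = 'a]
    by (auto simp: r_def field_simps)
  define C where "C = cbox (- (r *\<^sub>R One)) (r *\<^sub>R One :: 'a)"
  have "R ^ 4 / 4 * (R / DIM('a)) ^ DIM('a) = integral C (\<lambda>_. R ^ 4 / 4)"
    using r by (simp add: C_def content_cbox_if box_eq_empty r_def inner_simps not_less prod_constant)
  also have "\<dots> \<le> integral C (cutoff R)"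
  proof (rule integral_le)
    fix v :: 'a assume "v \<in> C"
    then have "\<bar>v \<bullet> b\<bar> \<le> r" if "b \<in> Basis" for b using that by (auto simp: C_def mem_box abs_le_iff) 
    then have "norm v \<le> (\<Sum>b\<in>(Basis::'a set). r)" by (intro order_trans[OF norm_le_l1] sum_mono)
    then show "R ^ 4 / 4 \<le> cutoff R v" using assms by (intro cutoff_ge) (auto simp: r_def)
  qed (auto simp: C_def intro!: integrable_continuous continuous_on_cutoff)
  also have "\<dots> \<le> integral (cbox (- (R *\<^sub>R One)) (R *\<^sub>R One :: 'a)) (cutoff R)"
    using r by (intro integral_subset_le)
      (auto simp: C_def cutoff_nonneg subset_box inner_simps intro!: integrable_continuous continuous_on_cutoff)
  finally show ?thesis .
qed

text \<open>Mass transported through the boundary of a ball of radius \<open>R\<close> by the bounded fluxes \<open>b i\<close>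
  is of order \<open>R\<close> to the power \<open>DIM('a) - 1\<close> only, too little to change the mean of the density.\<close>

lemma conservation_law_mean_le:
  fixes a a' :: "'a::euclidean_space \<Rightarrow> real \<Rightarrow> real" and b b' :: "'i \<Rightarrow> 'a \<Rightarrow> real \<Rightarrow> real"
  assumes t: "ta < tb" and fin: "finite I"
    and da: "\<And>v t. ((\<lambda>t. a v t) has_real_derivative a' v t) (at t)"
    and db: "\<And>i v t. i \<in> I \<Longrightarrow> ((\<lambda>s. b i (v + s *\<^sub>R u i) t) has_real_derivative b' i v t) (at 0)"
    and ca: "\<And>t. continuous_on UNIV (\<lambda>v. a v t)" "continuous_on UNIV (\<lambda>(t, v). a' v t)"
    and cb: "\<And>i t. i \<in> I \<Longrightarrow> continuous_on UNIV (\<lambda>v. b i v t)"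
      "\<And>i t. i \<in> I \<Longrightarrow> continuous_on UNIV (\<lambda>v. b' i v t)"
    and law: "\<And>v t. a' v t = (\<Sum>i\<in>I. b' i v t)"
    and bound: "\<And>i v t. i \<in> I \<Longrightarrow> ta \<le> t \<Longrightarrow> t \<le> tb \<Longrightarrow> \<bar>b i v t\<bar> \<le> M"
    and C0: "\<And>v. C0 \<le> a v ta" and C1: "\<And>v. a v tb \<le> C1"
  shows "C0 \<le> C1"
proof (rule ccontr)
  assume "\<not> C0 \<le> C1"
  then have C: "C1 < C0" by simp
  let ?d = "DIM('a)"
  \<comment> \<open>After division by R^(d + 3), \<open>L * R\<close> bounds the loss of
    cutoff-weighted mass from below and \<open>K\<close> bounds the transported mass from above.
    This is \<open>main\<close>, which fails for large R.\<close>
  define K where "K = (tb - ta) * (\<Sum>i\<in>I. 4 * norm (u i) * M * 2 ^ ?d)"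
  define L where "L = (C0 - C1) / (4 * real ?d ^ ?d)"
  have L: "L > 0" using C by (simp add: L_def)
  have main: "L * R \<le> K" if R: "R > 0" for R
  proof -
    define B where "B = cbox (- (R *\<^sub>R One)) (R *\<^sub>R One :: 'a)"
    have supp: "cutoff R v = 0" if "v \<notin> B" for v
    proof (rule cutoff_eq_0)
      show "R \<le> norm v"
      proof (rule ccontr)
        assume "\<not> R \<le> norm v"
        then have "\<bar>v \<bullet> b\<bar> \<le> R" if "b \<in> Basis" for b using Basis_le_norm[OF that, of v] by simp
        then have "v \<in> B" by (auto simp: B_def mem_box abs_le_iff minus_le_iff)
        then show False using that by simp
      qed
    qed (use R in simp)
    have cont: "continuous_on X f" if "continuous_on UNIV f" for X and f :: "'a \<Rightarrow> real"
      using that continuous_on_subset by blast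
    define E where "E t = integral B (\<lambda>v. cutoff R v * a v t)" for t
    define E' where "E' t = integral B (\<lambda>v. cutoff R v * a' v t)" for t
    have dE: "(E has_real_derivative E' t) (at t)" for t
      unfolding E_def E'_def B_def
    proof (rule leibniz_rule_field_derivative[of UNIV])
      show "((\<lambda>t. cutoff R v * a v t) has_real_derivative cutoff R v * a' v t) (at t)" for t v
        by (intro DERIV_cmult da)
      show "(\<lambda>v. cutoff R v * a v t) integrable_on cbox (- (R *\<^sub>R One)) (R *\<^sub>R One)" for t
        by (intro integrable_continuous continuous_intros continuous_on_cutoff cont[OF ca(1)])
      show "continuous_on (UNIV \<times> cbox (- (R *\<^sub>R One)) (R *\<^sub>R One)) (\<lambda>(t, v). cutoff R v * a' v t)"
        using continuous_on_subset[OF ca(2)] unfolding case_prod_unfold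
        by (intro continuous_intros continuous_on_compose2[OF continuous_on_cutoff(1)[of UNIV]]) auto
    qed auto
    have ca': "continuous_on UNIV (\<lambda>v. a' v t)" for t
    proof -
      have "continuous_on UNIV (\<lambda>v. case (t, v) of (t, v) \<Rightarrow> a' v t)"
        by (rule continuous_on_compose2[OF ca(2)]) (intro continuous_intros, simp)
      then show ?thesis by simp
    qed
    have E'_le: "\<bar>E' t\<bar> \<le> R ^ 3 * R ^ ?d * (\<Sum>i\<in>I. 4 * norm (u i) * M * 2 ^ ?d)"
      if "ta \<le> t" "t \<le> tb" for t
    proof -
      have int: "(\<lambda>v. cutoff R v * b' i v t) integrable_on B" "(\<lambda>v. cutoff' R (u i) v * b i v t) integrable_on B"
        if "i \<in> I" for i
        unfolding B_def
        by (intro integrable_continuous continuous_intros continuous_on_cutoff cont[OF cb(1)] cont[OF cb(2)] that)+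
      \<comment> \<open>Integration by parts moves the derivative onto the cutoff, whose derivative
        is smaller by one order of R.\<close>
      have ibp: "integral B (\<lambda>v. cutoff R v * b' i v t) = - integral B (\<lambda>v. cutoff' R (u i) v * b i v t)"
        if i: "i \<in> I" for i
      proof -
        have "integral B (\<lambda>v. cutoff' R (u i) v * b i v t + cutoff R v * b' i v t) = 0"
          unfolding B_def
        proof (rule integral_directional_derivative_compact_support)
          show "((\<lambda>s. cutoff R (v + s *\<^sub>R u i) * b i (v + s *\<^sub>R u i) t) has_real_derivative
              cutoff' R (u i) v * b i v t + cutoff R v * b' i v t) (at 0)" for v
            using DERIV_mult[OF has_real_derivative_cutoff[of R v "u i"] db[OF i, of v t]] by (simp add: mult.commute)
          show "cutoff R v * b i v t = 0" if "v \<notin> cbox (- (R *\<^sub>R One)) (R *\<^sub>R One)" for v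
            using supp that by (simp add: B_def)
        qed (intro continuous_intros continuous_on_cutoff cb i)+
        then show ?thesis using int[OF i] by (simp add: integral_add)
      qed
      have "E' t = (\<Sum>i\<in>I. integral B (\<lambda>v. cutoff R v * b' i v t))"
        unfolding E'_def law sum_distrib_left using int by (intro integral_sum fin) auto
      also have "\<dots> = - (\<Sum>i\<in>I. integral B (\<lambda>v. cutoff' R (u i) v * b i v t))"
        by (simp add: ibp sum_negf)
      finally have "\<bar>E' t\<bar> \<le> (\<Sum>i\<in>I. \<bar>integral B (\<lambda>v. cutoff' R (u i) v * b i v t)\<bar>)" by simp
      also have "\<dots> \<le> (\<Sum>i\<in>I. R ^ 3 * R ^ ?d * (4 * norm (u i) * M * 2 ^ ?d))"
      proof (rule sum_mono)
        fix i assume i: "i \<in> I"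
        have "norm (integral B (\<lambda>v. cutoff' R (u i) v * b i v t)) \<le> integral B (\<lambda>v. 4 * R ^ 3 * norm (u i) * M)"
        proof (rule integral_norm_bound_integral[OF int(2)[OF i]])
          show "norm (cutoff' R (u i) v * b i v t) \<le> 4 * R ^ 3 * norm (u i) * M" for v
            unfolding real_norm_def abs_mult
            using R by (intro mult_mono abs_cutoff'_le bound i \<open>ta \<le> t\<close> \<open>t \<le> tb\<close>) auto
        qed (simp add: B_def integrable_const)
        also have "\<dots> = R ^ 3 * R ^ ?d * (4 * norm (u i) * M * 2 ^ ?d)"
          using R by (simp add: B_def content_cbox_if box_eq_empty inner_simps not_less power_mult_distrib)
        finally show "\<bar>integral B (\<lambda>v. cutoff' R (u i) v * b i v t)\<bar> \<le> R ^ 3 * R ^ ?d * (4 * norm (u i) * M * 2 ^ ?d)"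
          by simp
      qed
      finally show ?thesis by (simp add: sum_distrib_left)
    qed
    obtain z where z: "ta < z" "z < tb" "E tb - E ta = (tb - ta) * E' z"
      using MVT2[OF t, of E E'] dE by blast
    have int: "(\<lambda>v. cutoff R v * f v) integrable_on B" if "continuous_on UNIV f" for f
      unfolding B_def by (intro integrable_continuous continuous_intros continuous_on_cutoff cont[OF that])
    have "(C0 - C1) * (R ^ 4 / 4 * (R / ?d) ^ ?d) \<le> (C0 - C1) * integral B (cutoff R)"
      unfolding B_def using C R by (intro mult_left_mono integral_cutoff_ge) auto
    also have "\<dots> = integral B (\<lambda>v. cutoff R v * (C0 - C1))" by (simp add: mult.commute)
    also have "\<dots> \<le> integral B (\<lambda>v. cutoff R v * a v ta - cutoff R v * a v tb)"
      using C0 C1 int[OF ca(1)] int[of "\<lambda>_. C0 - C1"]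
      by (intro integral_le integrable_diff) (auto simp flip: right_diff_distrib intro!: mult_left_mono cutoff_nonneg diff_mono)
    also have "\<dots> = E ta - E tb" unfolding E_def by (intro integral_diff int ca)
    also have "\<dots> \<le> (tb - ta) * \<bar>E' z\<bar>"
      using z(3) t abs_ge_minus_self[of "E' z"] mult_left_mono[of "- E' z" "\<bar>E' z\<bar>" "tb - ta"] by simp
    also have "\<dots> \<le> (tb - ta) * (R ^ 3 * R ^ ?d * (\<Sum>i\<in>I. 4 * norm (u i) * M * 2 ^ ?d))"
      using t z by (intro mult_left_mono E'_le) auto
    also have "\<dots> = R ^ 3 * R ^ ?d * K" by (simp add: K_def)
    also have "(C0 - C1) * (R ^ 4 / 4 * (R / ?d) ^ ?d) = R ^ 3 * R ^ ?d * (L * R)"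
      by (simp add: L_def power_divide eval_nat_numeral)
    finally have "R ^ 3 * R ^ ?d * (L * R) \<le> R ^ 3 * R ^ ?d * K" .
    then show ?thesis using R by simp
  qed
  \<comment> \<open>This choice of R turns \<open>main\<close> into |K| + 1 \<le> K.\<close>
  have "L * ((\<bar>K\<bar> + 1) / L) \<le> K" using L by (intro main) (simp add: add_nonneg_pos)
  then show False using L by simp
qed

section \<open>Hyper-Hermitian metrics on the suspension\<close>

definition IS :: "(real^8) \<times> (real^4) \<Rightarrow> (real^8) \<times> (real^4)" where
  "IS p = (I8 (fst p), I4 (snd p))"

definition JS :: "(real^8) \<times> (real^4) \<Rightarrow> (real^8) \<times> (real^4)" where
  "JS p = (J8 (fst p), J4 (snd p))"

lemma cx_suspension:
  "cxI suspension_S c p = IS" "cxJ suspension_S c p = JS" "cxK suspension_S c p = (\<lambda>v. IS (JS v))"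
  by (auto simp: suspension_S_def IS_def JS_def fun_eq_iff)

lemma cxI_suspension: "cxI suspension_S c = (\<lambda>_. IS)"
  by (rule ext) (rule cx_suspension)

lemma IS_JS_relations: "IS (IS v) = - v" "JS (JS v) = - v" "JS (IS v) = - IS (JS v)"
  by (simp_all add: IS_def JS_def IJ8_relations IJ4_relations prod_eq_iff)

lemma linear_IS: "linear IS" and linear_JS: "linear JS"
  unfolding IS_def[abs_def] JS_def[abs_def]
  by (rule linearI; simp add: linear_add linear_IJ linear_scale)+

lemmas IS_minus = linear_neg[OF linear_IS] and JS_minus = linear_neg[OF linear_JS]

definition std_chart :: "((real^8) \<times> (real^4)) set \<Rightarrow> (suspension_point, (real^8) \<times> (real^4)) chart" where
  "std_chart W = (S_proj ` W, inv_into W S_proj)"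

lemma S_atlas_std_chart:
  "c \<in> S_atlas \<longleftrightarrow> (\<exists>W. open W \<and> inj_on S_proj W \<and> c = std_chart W)"
  by (auto simp: suspension_S_def std_chart_def)

lemma chart_image_std_chart: "inj_on S_proj W \<Longrightarrow> chart_image (std_chart W) = W"
  using chart_image_S[of W UNIV] by (simp add: chart_image_def std_chart_def)

text \<open>Here the deck transformation is prescribed. Since \<open>deck m n z\<close> lies in
  \<open>V\<close> over the same point as z, injectivity of \<open>S_proj\<close> on
  \<open>V\<close> identifies it with the image of z under the transition. The same holds near z,
  whence the derivative.\<close>

lemma std_chart_transition:
  assumes W: "open W" "inj_on S_proj W" and V: "open V" "inj_on S_proj V"
    and n: "n \<in> lattice" and z: "z \<in> W" "deck m n z \<in> V"
  shows "z \<in> overlap (std_chart W) (std_chart V)"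
    and "transition (std_chart W) (std_chart V) z = deck m n z"
    and "frechet_derivative (transition (std_chart W) (std_chart V)) (at z) = deck_lin m"
proof -
  have t: "transition (std_chart W) (std_chart V) y = deck m n y" if "y \<in> W" "deck m n y \<in> V" for y
  proof -
    have "inv_into (S_proj ` W) (inv_into W S_proj) y = S_proj y"
      using that(1) W(2) by (intro inv_into_f_eq) (auto intro: inj_on_inv_into)
    then have "transition (std_chart W) (std_chart V) y = inv_into V S_proj (S_proj (deck m n y))"
      by (simp add: transition_def std_chart_def S_proj_deck[OF n])
    then show ?thesis using V(2) that(2) by simp
  qed
  then show "transition (std_chart W) (std_chart V) z = deck m n z" using z by blast
  show "z \<in> overlap (std_chart W) (std_chart V)"
    using z S_proj_deck[OF n, of m z]
    by (auto simp: overlap_def std_chart_def chart_image_S[OF W(2)] image_iff intro: bexI[of _ "deck m n z"])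
  have "open (W \<inter> deck m n -` V)"
    using continuous_deck[of UNIV m n] V(1) W(1) by (simp add: open_vimage open_Int)
  then show "frechet_derivative (transition (std_chart W) (std_chart V)) (at z) = deck_lin m"
    by (rule has_derivative_frechet(2)[OF bounded_linear_deck_lin]) (use z t deck_affine in auto)
qed

lemma overlap_std_chart:
  assumes W: "inj_on S_proj W" and V: "inj_on S_proj V"
    and z: "z \<in> overlap (std_chart W) (std_chart V)"
  obtains m n where "n \<in> lattice" "z \<in> W" "deck m n z \<in> V"
  using z by (auto simp: overlap_def std_chart_def chart_image_S[OF W] S_proj_eq_iff)

lemma Omega_suspension:
  "Omega suspension_S g c y w = complex_of_real (g c y (JS (w 0)) (w 1)) +
     \<i> * complex_of_real (g c y (IS (JS (w 0))) (w 1))"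
  by (simp add: Omega_def fundamental_form_def cx_suspension)

lemma hyper_hermitian_suspensionD:
  assumes "hyper_hermitian_metric suspension_S g" "c \<in> S_atlas" "y \<in> chart_image c"
  shows "bilinear (g c y)" "g c y v w = g c y w v" "v \<noteq> 0 \<Longrightarrow> g c y v v > 0"
    "g c y (IS v) (IS w) = g c y v w" "g c y (JS v) (JS w) = g c y v w"
    "g c y (- v) w = - g c y v w" "g c y v (- w) = - g c y v w"
    "g c y (IS v) w = - g c y v (IS w)" "g c y (JS v) w = - g c y v (JS w)"
proof -
  show b: "bilinear (g c y)" and "g c y v w = g c y w v" "v \<noteq> 0 \<Longrightarrow> g c y v v > 0"
    using assms unfolding hyper_hermitian_metric_def riemannian_metric_def by blast+
  show IJ: "g c y (IS v) (IS w) = g c y v w" "g c y (JS v) (JS w) = g c y v w" for v w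
    using assms by (simp_all add: hyper_hermitian_metric_def cx_suspension del: split_paired_All)
  show m: "g c y (- v) w = - g c y v w" "g c y v (- w) = - g c y v w" for v w
    using b by (simp_all add: bilinear_lneg bilinear_rneg)
  show "g c y (IS v) w = - g c y v (IS w)" "g c y (JS v) w = - g c y v (JS w)"
    using IJ(1)[of "IS v" w] IJ(2)[of "JS v" w] m by (simp_all add: IS_JS_relations)
qed

text \<open>\<Omega> has type (2, 0): replacing v by \<open>IS v\<close> turns \<open>JS v\<close>
  into \<open>- IS (JS v)\<close> and \<open>IS (JS v)\<close> into \<open>JS v\<close>, which
  multiplies \<Omega> by \<i>. In the second slot the skew-symmetry of \<open>IS\<close> has the
  same effect.\<close>

lemma Omega_suspension_top:
  assumes "hyper_hermitian_metric suspension_S g" "c \<in> S_atlas" "y \<in> chart_image c" "j < 2"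
  shows "Omega suspension_S g c y (v(j := IS (v j))) = \<i> * Omega suspension_S g c y v"
proof -
  note G = hyper_hermitian_suspensionD[OF assms(1-3)]
  have "j = 0 \<or> j = 1" using assms(4) by auto
  then show ?thesis
    by (auto simp: Omega_suspension IS_JS_relations IS_minus JS_minus G(6-9) algebra_simps)
qed

section \<open>A quaternionic balanced metric\<close>

lemma sum_permutes_4:
  "(\<Sum>\<sigma> | \<sigma> permutes {..<4::nat}. of_int (sign \<sigma>) * f (\<sigma> 0) (\<sigma> 1) (\<sigma> 2) (\<sigma> 3)) =
    (f 0 1 2 3 - f 0 1 3 2 - f 0 2 1 3 + f 0 2 3 1 + f 0 3 1 2 - f 0 3 2 1
     - f 1 0 2 3 + f 1 0 3 2 + f 1 2 0 3 - f 1 2 3 0 - f 1 3 0 2 + f 1 3 2 0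
     + f 2 0 1 3 - f 2 0 3 1 - f 2 1 0 3 + f 2 1 3 0 + f 2 3 0 1 - f 2 3 1 0
     - f 3 0 1 2 + f 3 0 2 1 + f 3 1 0 2 - f 3 1 2 0 - f 3 2 0 1 + f 3 2 1 0 :: complex)"
proof -
  have *: "{..<4::nat} = insert 0 (insert 1 (insert 2 (insert 3 {})))" by auto
  show ?thesis
    unfolding *
    by (simp add: sum_over_permutations_insert permutes_sing sign_swap_id permutation_swap_id
        sign_compose permutation_compose transpose_def)
qed

lemma sum_permutes_2:
  "(\<Sum>\<sigma> | \<sigma> permutes {..<2::nat}. of_int (sign \<sigma>) * f (\<sigma> 0) (\<sigma> 1)) = (f 0 1 - f 1 0 :: complex)"
proof -
  have *: "{..<2::nat} = insert 0 (insert 1 {})" by auto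
  show ?thesis
    unfolding *
    by (simp add: sum_over_permutations_insert permutes_sing sign_swap_id permutation_swap_id
        sign_compose permutation_compose transpose_def)
qed

text \<open>By skew-symmetry the 24 permutations fall into the three pairings of four slots, with
  eight equal terms each; division by 2! 2! leaves the factor 2.\<close>

lemma two_form_power_2:
  assumes "\<And>v. \<omega> x v = B (v 0) (v 1)" and skew: "\<And>a b. B b a = - B a b"
  shows "two_form_power \<omega> 2 x v =
    2 * (B (v 0) (v 1) * B (v 2) (v 3) - B (v 0) (v 2) * B (v 1) (v 3) + B (v 0) (v 3) * B (v 1) (v 2))"
proof -
  \<comment> \<open>The first power is the wedge product of the constant 1 with \<omega>, an
    antisymmetrization that gives back \<open>B\<close> because \<open>B\<close> is skew.\<close>
  have 1: "two_form_power \<omega> 1 x w = B (w 0) (w 1)" for w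
  proof -
    have "two_form_power \<omega> 1 x w =
       (\<Sum>\<sigma> | \<sigma> permutes {..<2::nat}. of_int (sign \<sigma>) * B (w (\<sigma> 0)) (w (\<sigma> 1))) / 2"
      by (simp add: wedge_def assms(1) flip: numeral_2_eq_2)
    also have "\<dots> = B (w 0) (w 1)"
      unfolding sum_permutes_2[of "\<lambda>i j. B (w i) (w j)"] by (simp add: skew[of "w 0" "w (Suc 0)"])
    finally show ?thesis .
  qed
  have "two_form_power \<omega> 2 x v = wedge 2 2 (two_form_power \<omega> 1) \<omega> x v"
    by (simp add: numeral_2_eq_2)
  also have "\<dots> = (\<Sum>\<sigma> | \<sigma> permutes {..<4::nat}. of_int (sign \<sigma>) *
      (B (v (\<sigma> 0)) (v (\<sigma> 1)) * B (v (\<sigma> 2)) (v (\<sigma> 3)))) / 4"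
    unfolding wedge_def 1 assms(1) by (simp add: mult.assoc fact_numeral)
  also have "\<dots> = 2 * (B (v 0) (v 1) * B (v 2) (v 3) - B (v 0) (v 2) * B (v 1) (v 3)
      + B (v 0) (v 3) * B (v 1) (v 2))"
    unfolding sum_permutes_4[of "\<lambda>i j k l. B (v i) (v j) * B (v k) (v l)"]
    by (simp add: skew[of "v 0" "v (Suc 0)"] skew[of "v 0" "v 2"] skew[of "v 0" "v 3"]
        skew[of "v (Suc 0)" "v 2"] skew[of "v (Suc 0)" "v 3"] skew[of "v 2" "v 3"] add_divide_distrib
        diff_divide_distrib algebra_simps)
  finally show ?thesis .
qed

definition wedge11 :: "('e \<Rightarrow> complex) \<Rightarrow> ('e \<Rightarrow> complex) \<Rightarrow> 'e \<Rightarrow> 'e \<Rightarrow> complex" where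
  "wedge11 \<alpha> \<beta> v w = \<alpha> v * \<beta> w - \<beta> v * \<alpha> w"

text \<open>The wedge product of two-forms as a sum over the six (2, 2)-shuffles.\<close>

definition wedge22 :: "('e \<Rightarrow> 'e \<Rightarrow> complex) \<Rightarrow> ('e \<Rightarrow> 'e \<Rightarrow> complex) \<Rightarrow> (nat \<Rightarrow> 'e) \<Rightarrow> complex" where
  "wedge22 \<omega> \<omega>' v =
     \<omega> (v 0) (v 1) * \<omega>' (v 2) (v 3) + \<omega>' (v 0) (v 1) * \<omega> (v 2) (v 3)
     - \<omega> (v 0) (v 2) * \<omega>' (v 1) (v 3) - \<omega>' (v 0) (v 2) * \<omega> (v 1) (v 3)
     + \<omega> (v 0) (v 3) * \<omega>' (v 1) (v 2) + \<omega>' (v 0) (v 3) * \<omega> (v 1) (v 2)"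

text \<open>The sum is the wedge product of \<gamma>, \<alpha>, \<beta>, \<delta>, \<gamma>
  evaluated on v; the factor \<gamma> occurs twice.\<close>

lemma wedge22_repeated_factor:
  "(\<Sum>i\<le>4. (-1) ^ i * (\<gamma> (v i) * wedge22 (wedge11 \<alpha> \<beta>) (wedge11 \<delta> \<gamma>) (face i v))) = 0"
  by (simp add: eval_nat_numeral atMost_Suc face_def wedge22_def wedge11_def algebra_simps)

text \<open>Decomposable two-forms have square zero (\<open>sq\<close>, the Pluecker relation), so
  only the mixed products survive.\<close>

lemma two_form_power_2_decomposable:
  assumes "\<And>v. \<omega> x v = a * wedge11 \<alpha>1 \<beta>1 (v 0) (v 1) + b * wedge11 \<alpha>2 \<beta>2 (v 0) (v 1)
      + wedge11 \<alpha>3 \<beta>3 (v 0) (v 1)"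
  shows "two_form_power \<omega> 2 x v =
     2 * (a * b * wedge22 (wedge11 \<alpha>1 \<beta>1) (wedge11 \<alpha>2 \<beta>2) v
        + a * wedge22 (wedge11 \<alpha>1 \<beta>1) (wedge11 \<alpha>3 \<beta>3) v
        + b * wedge22 (wedge11 \<alpha>2 \<beta>2) (wedge11 \<alpha>3 \<beta>3) v)"
proof -
  define B where "B v w = a * wedge11 \<alpha>1 \<beta>1 v w + b * wedge11 \<alpha>2 \<beta>2 v w + wedge11 \<alpha>3 \<beta>3 v w" for v w
  have sq: "wedge11 \<alpha> \<beta> (v 0) (v 1) * wedge11 \<alpha> \<beta> (v 2) (v 3) - wedge11 \<alpha> \<beta> (v 0) (v 2) * wedge11 \<alpha> \<beta> (v 1) (v 3)
      + wedge11 \<alpha> \<beta> (v 0) (v 3) * wedge11 \<alpha> \<beta> (v 1) (v 2) = 0" for \<alpha> \<beta>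
    by (simp add: wedge11_def algebra_simps)
  have "two_form_power \<omega> 2 x v =
    2 * (B (v 0) (v 1) * B (v 2) (v 3) - B (v 0) (v 2) * B (v 1) (v 3) + B (v 0) (v 3) * B (v 1) (v 2))"
    by (rule two_form_power_2) (simp_all add: assms B_def wedge11_def algebra_simps)
  then show ?thesis
    using sq[of \<alpha>1 \<beta>1] sq[of \<alpha>2 \<beta>2] sq[of \<alpha>3 \<beta>3] unfolding B_def wedge22_def by algebra
qed

section \<open>Metrics of quaternionic rank one\<close>

text \<open>The Euclidean metric of the quaternions, pulled back by the map whose components are l
  and its compositions with I, J and IJ.\<close>

definition quat_form :: "((real^8) \<times> (real^4) \<Rightarrow> real) \<Rightarrow> (real^8) \<times> (real^4) \<Rightarrow> (real^8) \<times> (real^4) \<Rightarrow> real" where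
  "quat_form l v w = l v * l w + l (IS v) * l (IS w) + l (JS v) * l (JS w) + l (IS (JS v)) * l (IS (JS w))"

lemma quat_form_nonneg: "0 \<le> quat_form l v v"
  by (simp add: quat_form_def)

lemma quat_form_eq_0:
  assumes "quat_form l v v = 0"
  shows "l v = 0" "l (IS v) = 0" "l (JS v) = 0" "l (IS (JS v)) = 0"
proof -
  have "(l v)\<^sup>2 + (l (IS v))\<^sup>2 + (l (JS v))\<^sup>2 + (l (IS (JS v)))\<^sup>2 = 0"
    using assms by (simp add: quat_form_def power2_eq_square)
  then show "l v = 0" "l (IS v) = 0" "l (JS v) = 0" "l (IS (JS v)) = 0"
    by (simp_all add: add_nonneg_eq_0_iff)
qed

lemma quat_form_commute: "quat_form l v w = quat_form l w v"
  by (simp add: quat_form_def mult.commute)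

lemma bilinear_quat_form: "linear l \<Longrightarrow> bilinear (quat_form l)"
  unfolding bilinear_def
  by (intro conjI allI linearI)
    (simp_all add: quat_form_def linear_add linear_scale linear_IS linear_JS algebra_simps)

lemma quat_form_IS_JS:
  assumes "linear l"
  shows "quat_form l (IS v) (IS w) = quat_form l v w" "quat_form l (JS v) (JS w) = quat_form l v w"
  by (simp_all add: quat_form_def IS_JS_relations IS_minus linear_neg[OF assms])

text \<open>\<open>alpha l\<close> and \<open>beta l\<close> are the \<open>I\<close>-linear parts of the quaternion-linear extension of \<open>l\<close>.\<close>

definition alpha :: "((real^8) \<times> (real^4) \<Rightarrow> real) \<Rightarrow> (real^8) \<times> (real^4) \<Rightarrow> complex" where
  "alpha l v = complex_of_real (l v) - \<i> * complex_of_real (l (IS v))"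

definition beta :: "((real^8) \<times> (real^4) \<Rightarrow> real) \<Rightarrow> (real^8) \<times> (real^4) \<Rightarrow> complex" where
  "beta l v = complex_of_real (l (JS v)) + \<i> * complex_of_real (l (IS (JS v)))"

lemma alpha_beta_IS:
  assumes "linear l"
  shows "alpha l (IS v) = \<i> * alpha l v" "beta l (IS v) = \<i> * beta l v"
  by (simp_all add: alpha_def beta_def IS_JS_relations IS_minus linear_neg[OF assms] algebra_simps)

text \<open>The left side is the \<Omega> of \<open>quat_form l\<close>. Quaternionic rank one makes
  it decomposable, as \<open>two_form_power_2_decomposable\<close> requires.\<close>

lemma quat_form_wedge11:
  assumes "linear l"
  shows "complex_of_real (quat_form l (JS v) w) + \<i> * complex_of_real (quat_form l (IS (JS v)) w) =
    wedge11 (beta l) (alpha l) v w"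
  by (simp add: complex_eq_iff quat_form_def wedge11_def alpha_def beta_def IS_JS_relations IS_minus
      linear_neg[OF assms] algebra_simps)

section \<open>Eigenforms of A\<close>

text \<open>For \<open>r\<^sup>2 = 2\<close> this is the first row of \<open>r + (A\<^sup>2 + 3) / 2\<close>, a left eigenvector of \<open>A\<^sup>2\<close>
  with eigenvalue \<open>2 r - 3\<close>.\<close>

definition eigen_functional :: "real \<Rightarrow> real^8 \<Rightarrow> real" where
  "eigen_functional r v = r * v $ 1 - v $ 2 + v $ 3 + v $ 4 - v $ 5 + v $ 6 + v $ 8"

text \<open>A commutes with I and J. On the quaternionic coordinate with real part
  \<open>eigen_functional r\<close> it acts by right multiplication with (r / 2 - 1) (i + j), whose
  squared length is 3 - 2 r.\<close>

lemma eigen_functional_A_mat: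
  assumes "r\<^sup>2 = 2"
  shows "eigen_functional r (A_mat *v v) =
    (r / 2 - 1) * (eigen_functional r (I8 v) + eigen_functional r (J8 v))"
proof -
  have rr: "r * (r * x) = 2 * x" for x using assms by (simp add: power2_eq_square flip: mult.assoc)
  show ?thesis
    by (simp add: eigen_functional_def A_mat_mult I8_def J8_def vector_8 field_simps rr)
qed

definition eigen_form :: "real \<Rightarrow> (real^8) \<times> (real^4) \<Rightarrow> (real^8) \<times> (real^4) \<Rightarrow> real" where
  "eigen_form r = quat_form (\<lambda>p. eigen_functional r (fst p))"

lemma linear_eigen_functional: "linear (\<lambda>p. eigen_functional r (fst p))"
  by (rule linearI) (simp_all add: eigen_functional_def algebra_simps)

lemma eigen_form_A_mat:
  assumes "r\<^sup>2 = 2"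
  shows "eigen_form r (A_mat *v v, x) (A_mat *v w, y) = (3 - 2 * r) * eigen_form r (v, x) (w, y)"
proof -
  note neg = linear_neg[OF linear_eigen_functional[of r], of "(_, 0)", simplified]
  \<comment> \<open>The missing factor 2 arises because, in the sum over 1, I, J and IJ, the mixed
    products cancel and each pure square occurs twice.\<close>
  have sq: "(r / 2 - 1) * a * ((r / 2 - 1) * b) = (3 - 2 * r) / 2 * (a * b)" for a b
  proof -
    have "(r / 2 - 1) * (r / 2 - 1) = (3 - 2 * r) / 2"
      using assms by (simp add: power2_eq_square field_simps)
    then show ?thesis by (metis mult.assoc mult.left_commute)
  qed
  show ?thesis
    unfolding eigen_form_def quat_form_def
    by (simp add: IS_def JS_def A_mat_I8[symmetric] A_mat_J8[symmetric]
      eigen_functional_A_mat[OF assms] IJ8_relations neg linear_neg linear_IJ sq) (simp add: field_simps)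
qed

text \<open>3 + 2 sqrt 2 is the square of 1 + sqrt 2: the factor by which A multiplies the expanding
  eigenform, the one with r = - sqrt 2.\<close>

definition dilation :: real where "dilation = ln (3 + 2 * sqrt 2)"

lemma exp_dilation: "exp dilation = 3 + 2 * sqrt 2" "exp (- dilation) = 3 - 2 * sqrt 2"
proof -
  have pos: "3 + 2 * sqrt 2 > (0::real)" by (simp add: add_pos_nonneg)
  then show e: "exp dilation = 3 + 2 * sqrt 2" by (simp add: dilation_def)
  have "(3 + 2 * sqrt 2) * (3 - 2 * sqrt 2) = (1::real)" by (simp add: algebra_simps)
  then show "exp (- dilation) = 3 - 2 * sqrt 2"
    using pos by (simp add: exp_minus e field_simps)
qed

lemma dilation_pos: "dilation > 0"
  by (simp add: dilation_def add_pos_nonneg)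

lemma eigen_form_A_pow:
  assumes r: "r\<^sup>2 = 2" and e: "exp \<kappa> = 3 - 2 * r"
  shows "eigen_form r (A_pow k v, x) (A_pow k w, y) = exp (\<kappa> * of_int k) * eigen_form r (v, x) (w, y)"
proof (induction k rule: int_induct[of _ 0])
  case base
  then show ?case by (simp add: A_pow_0)
next
  case (step1 i)
  then show ?case
    by (simp add: A_pow_Suc eigen_form_A_mat[OF r] distrib_left exp_add flip: e)
next
  case (step2 i)
  have "exp \<kappa> * eigen_form r (A_pow (i - 1) v, x) (A_pow (i - 1) w, y) = eigen_form r (A_pow i v, x) (A_pow i w, y)"
    by (simp add: A_pow_pred A_inv e flip: eigen_form_A_mat[OF r])
  then show ?case
    using step2 by (simp add: right_diff_distrib exp_diff field_simps)
qed

definition eucl_form :: "(real^8) \<times> (real^4) \<Rightarrow> (real^8) \<times> (real^4) \<Rightarrow> real" where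
  "eucl_form = quat_form (\<lambda>p. snd p $ 1)"

lemma linear_snd_1: "linear (\<lambda>p :: (real^8) \<times> (real^4). snd p $ 1)"
  by (rule linearI) simp_all

section \<open>The balanced metric\<close>

text \<open>A deck transformation adds \<open>m $ 1\<close> to the first coordinate of \<real>^4.
  Each exponential thereby gains exactly the inverse of the factor by which the power of A scales
  the eigenform next to it.\<close>

definition balanced_form ::
  "(real^8) \<times> (real^4) \<Rightarrow> (real^8) \<times> (real^4) \<Rightarrow> (real^8) \<times> (real^4) \<Rightarrow> real" where
  "balanced_form p v w = exp (dilation * snd p $ 1) * eigen_form (sqrt 2) v w
     + exp (- dilation * snd p $ 1) * eigen_form (- sqrt 2) v w + eucl_form v w"

text \<open>If both eigenforms vanish on v, the functionals for r = sqrt 2 and r = - sqrt 2 vanish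
  on the torus part a of v and on its images under I, J and IJ. They differ by a multiple of the
  first coordinate, so \<open>ker\<close> gives two equations for each of these vectors, eight in
  all, with 0 as the only solution.\<close>

lemma balanced_form_pos:
  assumes "v \<noteq> 0"
  shows "balanced_form p v v > 0"
proof (rule ccontr)
  assume "\<not> balanced_form p v v > 0"
  moreover have "0 \<le> exp (dilation * snd p $ 1) * eigen_form (sqrt 2) v v"
    "0 \<le> exp (- dilation * snd p $ 1) * eigen_form (- sqrt 2) v v" "0 \<le> eucl_form v v"
    by (simp_all add: eigen_form_def eucl_form_def quat_form_nonneg)
  ultimately have "exp (dilation * snd p $ 1) * eigen_form (sqrt 2) v v = 0"
    "exp (- dilation * snd p $ 1) * eigen_form (- sqrt 2) v v = 0" "eucl_form v v = 0"
    unfolding balanced_form_def by linarith+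
  then have 0: "eigen_form (sqrt 2) v v = 0" "eigen_form (- sqrt 2) v v = 0" "eucl_form v v = 0"
    by simp_all
  obtain a x where v: "v = (a, x)" by fastforce
  have ker: "b $ 1 = 0 \<and> - b $ 2 + b $ 3 + b $ 4 - b $ 5 + b $ 6 + b $ 8 = 0"
    if "eigen_functional (sqrt 2) b = 0" "eigen_functional (- sqrt 2) b = 0" for b
  proof -
    have "2 * (sqrt 2 * b $ 1) = 0" using that unfolding eigen_functional_def by linarith
    then show ?thesis using that by (simp add: eigen_functional_def)
  qed
  have "a = 0"
    using quat_form_eq_0[OF 0(1)[unfolded eigen_form_def]] quat_form_eq_0[OF 0(2)[unfolded eigen_form_def]]
      ker[of a] ker[of "I8 a"] ker[of "J8 a"] ker[of "I8 (J8 a)"]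
    by (simp add: v IS_def JS_def) (simp add: vec_eq_iff forall_8 I8_def J8_def vector_8)
  moreover have "x = 0"
    using quat_form_eq_0[OF 0(3)[unfolded eucl_form_def]]
    by (simp add: v IS_def JS_def vec_eq_iff forall_4 I4_def J4_def vector_4)
  ultimately show False using assms v by (simp add: zero_prod_def)
qed

lemma balanced_form_deck:
  "balanced_form (deck m n p) (deck_lin m v) (deck_lin m w) = balanced_form p v w"
proof -
  obtain a x where v: "v = (a, x)" by fastforce
  obtain b y where w: "w = (b, y)" by fastforce
  have e: "eigen_form (sqrt 2) (deck_lin m v) (deck_lin m w) = exp (- dilation * m $ 1) * eigen_form (sqrt 2) v w"
    "eigen_form (- sqrt 2) (deck_lin m v) (deck_lin m w) = exp (dilation * m $ 1) * eigen_form (- sqrt 2) v w"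
    unfolding v w deck_lin_def
    using eigen_form_A_pow[of "sqrt 2" "- dilation"] eigen_form_A_pow[of "- sqrt 2" dilation]
    by (simp_all add: exp_dilation)
  have "eucl_form (deck_lin m v) (deck_lin m w) = eucl_form v w"
    by (simp add: v w deck_lin_def eucl_form_def quat_form_def IS_def JS_def)
  moreover have "snd (deck m n p) $ 1 = snd p $ 1 + m $ 1"
    by (simp add: deck_def of_int_vec_def split: prod.split)
  ultimately show ?thesis
    unfolding balanced_form_def e by (simp add: distrib_left exp_add exp_diff exp_minus field_simps)
qed

lemma has_derivative_exp_coordinate:
  fixes p :: "'a::real_normed_vector \<times> (real^'n)" and a b c k :: real
  shows "((\<lambda>p. a * exp (k * snd p $ i) + b * exp (- k * snd p $ i) + c) has_derivative
    (\<lambda>v. (k * snd v $ i * a) * exp (k * snd p $ i) + (- k * snd v $ i * b) * exp (- k * snd p $ i) + 0)) (at p)"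
proof -
  have d: "((\<lambda>p::'a \<times> (real^'n). snd p $ i) has_derivative (\<lambda>v. snd v $ i)) (at p)"
    by (intro bounded_linear_imp_has_derivative bounded_linear_vec_nth[THEN bounded_linear_compose] bounded_linear_snd)
  show ?thesis
    by (auto intro!: derivative_eq_intros d simp: algebra_simps fun_eq_iff)
qed

text \<open>With arbitrary a, b, c this family is closed under directional derivatives, which drives
  the induction on the order.\<close>

lemma smooth_on_exp_coordinate:
  fixes U :: "('a::euclidean_space \<times> (real^'n)) set" and a b c k :: real
  shows "smooth_on U (\<lambda>p. a * exp (k * snd p $ i) + b * exp (- k * snd p $ i) + c)"
proof -
  have "Ck_on j (\<lambda>p::'a \<times> (real^'n). a * exp (k * snd p $ i) + b * exp (- k * snd p $ i) + c) U" for j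
  proof (induction j arbitrary: a b c)
    case 0
    show ?case
      using has_derivative_continuous[OF has_derivative_exp_coordinate]
      by (auto intro: continuous_at_imp_continuous_on)
  next
    case (Suc j)
    have d: "frechet_derivative (\<lambda>p::'a \<times> (real^'n). a * exp (k * snd p $ i) + b * exp (- k * snd p $ i) + c) (at p) =
        (\<lambda>v. (k * snd v $ i * a) * exp (k * snd p $ i) + (- k * snd v $ i * b) * exp (- k * snd p $ i) + 0)" for p
      by (rule frechet_derivative_at[symmetric]) (rule has_derivative_exp_coordinate)
    show ?case
      unfolding Ck_on.simps(2) d using Suc.IH has_derivative_exp_coordinate differentiableI by blast
  qed
  then show ?thesis by (simp add: smooth_on_def)
qed

lemma bilinear_balanced_form: "bilinear (balanced_form p)"
proof -
  have b: "bilinear (eigen_form r)" "bilinear eucl_form" for r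
    unfolding eigen_form_def eucl_form_def
    by (intro bilinear_quat_form linear_eigen_functional linear_snd_1)+
  show ?thesis
    using b unfolding bilinear_def balanced_form_def[abs_def]
    by (auto simp: linear_iff algebra_simps simp del: split_paired_All)
qed

lemma balanced_form_IS_JS:
  "balanced_form p (IS v) (IS w) = balanced_form p v w"
  "balanced_form p (JS v) (JS w) = balanced_form p v w"
  by (simp_all add: balanced_form_def eigen_form_def eucl_form_def
      quat_form_IS_JS linear_eigen_functional linear_snd_1)

lemma hyper_hermitian_balanced_form:
  "hyper_hermitian_metric suspension_S (\<lambda>c. balanced_form)"
proof -
  have "smooth_on U (\<lambda>p. balanced_form p v w)" for U v w
    using smooth_on_exp_coordinate[of U "eigen_form (sqrt 2) v w" dilation 1 "eigen_form (- sqrt 2) v w" "eucl_form v w"]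
    by (simp add: balanced_form_def mult.commute)
  moreover have "balanced_form p v w = balanced_form p w v" for p v w
    by (simp add: balanced_form_def eigen_form_def eucl_form_def quat_form_commute)
  moreover have "balanced_form (transition c d y) (frechet_derivative (transition c d) (at y) v)
      (frechet_derivative (transition c d) (at y) w) = balanced_form y v w"
    if c: "c \<in> S_atlas" and d: "d \<in> S_atlas" and y: "y \<in> overlap c d" for c d y v w
  proof -
    obtain W V where W: "open W" "inj_on S_proj W" "c = std_chart W"
      and V: "open V" "inj_on S_proj V" "d = std_chart V"
      using c d by (auto simp: S_atlas_std_chart)
    obtain m n where mn: "n \<in> lattice" "y \<in> W" "deck m n y \<in> V"
      using overlap_std_chart[OF W(2) V(2)] y W(3) V(3) by metis
    show ?thesis
      unfolding W(3) V(3) std_chart_transition(2,3)[OF W(1,2) V(1,2) mn] by (rule balanced_form_deck)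
  qed
  ultimately have "riemannian_metric S_atlas (\<lambda>c. balanced_form)"
    unfolding riemannian_metric_def using bilinear_balanced_form balanced_form_pos by blast
  then show ?thesis
    by (simp add: hyper_hermitian_metric_def cx_suspension balanced_form_IS_JS del: split_paired_All)
qed

lemma quaternionic_balanced_form: "quaternionic_balanced_metric suspension_S (\<lambda>c. balanced_form)"
proof -
  define l :: "nat \<Rightarrow> (real^8) \<times> (real^4) \<Rightarrow> real" where
    "l i p = (if i = 1 then eigen_functional (sqrt 2) (fst p)
      else if i = 2 then eigen_functional (- sqrt 2) (fst p) else snd p $ 1)" for i p
  have lin: "linear (l i)" for i
    unfolding l_def[abs_def] using linear_eigen_functional linear_snd_1 by (cases "i = 1"; cases "i = 2") simp_all
  define \<omega> where "\<omega> i = wedge11 (beta (l i)) (alpha (l i))" for i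
  define f :: "(real^8) \<times> (real^4) \<Rightarrow> real" where "f y = exp (dilation * snd y $ 1)" for y
  have l: "eigen_form (sqrt 2) = quat_form (l 1)" "eigen_form (- sqrt 2) = quat_form (l 2)"
    "eucl_form = quat_form (l 3)"
    by (simp_all add: eigen_form_def eucl_form_def l_def[abs_def])
  have Om: "Omega suspension_S (\<lambda>c. balanced_form) c y v = of_real (f y) * \<omega> 1 (v 0) (v 1)
      + of_real (inverse (f y)) * \<omega> 2 (v 0) (v 1) + \<omega> 3 (v 0) (v 1)" for c y v
    unfolding \<omega>_def quat_form_wedge11[OF lin, symmetric]
    by (simp add: Omega_suspension balanced_form_def l f_def exp_minus algebra_simps)
  define P where "P i j = wedge22 (\<omega> i) (\<omega> j)" for i j
  \<comment> \<open>The real dimension is 12, so n = 3 and the relevant power is \<Omega>^2, of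
    degree 4.\<close>
  define \<Theta> where "\<Theta> c = two_form_power (Omega suspension_S (\<lambda>c. balanced_form) c) 2" for c
  \<comment> \<open>The coefficient of \<open>P 1 2\<close> is f times its inverse, so this term is
    constant.\<close>
  have \<Theta>: "\<Theta> c y v = 2 * (P 1 2 v + of_real (f y) * P 1 3 v + of_real (inverse (f y)) * P 2 3 v)" for c y v
    using two_form_power_2_decomposable[of "Omega suspension_S (\<lambda>c. balanced_form) c" y, OF Om[unfolded \<omega>_def]]
    by (simp add: \<Theta>_def P_def \<omega>_def f_def)
  have P_IS: "P i j (v(k := IS (v k))) = \<i> * P i j v" if "k < 4" for i j v k
  proof -
    have "\<omega> i (IS a) b = \<i> * \<omega> i a b" "\<omega> i a (IS b) = \<i> * \<omega> i a b" for i a b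
      by (simp_all add: \<omega>_def wedge11_def alpha_beta_IS lin algebra_simps)
    moreover have "k = 0 \<or> k = 1 \<or> k = 2 \<or> k = 3" using that by auto
    ultimately show ?thesis by (auto simp: P_def wedge22_def algebra_simps)
  qed
  have d\<Theta>: "((\<lambda>y. \<Theta> c y v) has_derivative (\<lambda>a. of_real (snd a $ 1) * (2 * of_real dilation *
      (of_real (f y) * P 1 3 v - of_real (inverse (f y)) * P 2 3 v)))) (at y)" for c y v
  proof -
    have d: "(f has_derivative (\<lambda>a. dilation * snd a $ 1 * f y)) (at y)"
      "((\<lambda>y. inverse (f y)) has_derivative (\<lambda>a. - dilation * snd a $ 1 * inverse (f y))) (at y)"
      using has_derivative_exp_coordinate[of 1 dilation 1 0 0 y]
        has_derivative_exp_coordinate[of 1 "- dilation" 1 0 0 y]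
      by (simp_all add: f_def[abs_def] exp_minus algebra_simps)
    show ?thesis
      unfolding \<Theta>
      by (rule has_derivative_eq_rhs, (rule derivative_intros d)+) (simp add: fun_eq_iff algebra_simps)
  qed
  have "del (\<lambda>_. IS) 4 (\<Theta> c) y v = 0" for c y v
  proof -
    have "del (\<lambda>_. IS) 4 (\<Theta> c) y v = (\<Sum>i\<le>4. (-1) ^ i *
       (frechet_derivative (\<lambda>y. \<Theta> c y (face i v)) (at y) (v i) -
        \<i> * frechet_derivative (\<lambda>y. \<Theta> c y (face i v)) (at y) (IS (v i)))) / 2"
    proof (rule del_top_form[of UNIV])
      show "\<Theta> c y (v(j := IS (v j))) = \<i> * \<Theta> c y v" if "j < 4" for y v j
        unfolding \<Theta> P_IS[OF that] by (simp add: algebra_simps)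
      show "(\<lambda>y. \<Theta> c y v) differentiable at y" for v using d\<Theta> differentiableI by blast
    qed auto
    \<comment> \<open>The (1, 0)-combination of the differential of the coordinate
      \<open>snd y $ 1\<close> is \<open>alpha (l 3)\<close>, a factor of \<open>\<omega> 3\<close>.
      Both sums therefore have a repeated factor.\<close>
    also have "\<dots> = (\<Sum>i\<le>4. (-1) ^ i * (alpha (l 3) (v i) * P 1 3 (face i v))) * of_real (dilation * f y)
      - (\<Sum>i\<le>4. (-1) ^ i * (alpha (l 3) (v i) * P 2 3 (face i v))) * of_real (dilation * inverse (f y))"
      unfolding frechet_derivative_at[OF d\<Theta>, symmetric] sum_divide_distrib sum_distrib_right sum_subtractf[symmetric]
      by (rule sum.cong) (simp_all add: alpha_def l_def algebra_simps add_divide_distrib diff_divide_distrib)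
    also have "\<dots> = 0"
      unfolding P_def \<omega>_def wedge22_repeated_factor by simp
    finally show ?thesis .
  qed
  then show ?thesis
    unfolding quaternionic_balanced_metric_def \<Theta>_def
    by (simp add: hyper_hermitian_balanced_form cxI_suspension Let_def)
qed

section \<open>Nonexistence of HKT metrics\<close>

lemma frechet_derivative_cong_open:
  assumes "open U" "x \<in> U" "\<And>z. z \<in> U \<Longrightarrow> f z = f' z"
  shows "frechet_derivative f (at x) = frechet_derivative f' (at x)"
proof -
  have "(f has_derivative D) (at x) \<longleftrightarrow> (f' has_derivative D) (at x)" for D
    using assms has_derivative_transform_within_open[of _ D x UNIV U] by (metis (no_types))
  then show ?thesis by (simp add: frechet_derivative_def)
qed

text \<open>Meant for \<open>lift_metric\<close>, which uses a different chart at every point and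
  agrees with a smooth chart representation only locally.\<close>

lemma C1_locally:
  assumes "\<And>x. \<exists>U f'. open U \<and> x \<in> U \<and> Ck_on (Suc 0) f' U \<and> (\<forall>z\<in>U. f z = f' z)"
  shows "f differentiable (at x)" and "continuous_on UNIV (\<lambda>x. frechet_derivative f (at x) v)"
proof -
  have "f differentiable (at x) \<and> isCont (\<lambda>x. frechet_derivative f (at x) v) x" for x
  proof -
    obtain U f' where U: "open U" "x \<in> U" "Ck_on (Suc 0) f' U" "\<forall>z\<in>U. f z = f' z"
      using assms by blast
    have "(f' has_derivative frechet_derivative f' (at x)) (at x)"
      using U(2,3) frechet_derivative_works by auto
    then have "(f has_derivative frechet_derivative f' (at x)) (at x)"
      by (rule has_derivative_transform_within_open[OF _ U(1,2)]) (use U(4) in auto)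
    moreover have "isCont (\<lambda>x. frechet_derivative f' (at x) v) x"
      using U(1-3) by (simp add: continuous_on_eq_continuous_at)
    moreover have "\<forall>\<^sub>F z in nhds x. frechet_derivative f (at z) v = frechet_derivative f' (at z) v"
      using eventually_nhds_in_open[OF U(1,2)]
      by eventually_elim (use frechet_derivative_cong_open[OF U(1)] U(4) in metis)
    ultimately show ?thesis by (auto simp: isCont_cong differentiableI)
  qed
  then show "f differentiable (at x)" "continuous_on UNIV (\<lambda>x. frechet_derivative f (at x) v)"
    by (auto intro: continuous_at_imp_continuous_on)
qed

text \<open>The pullback of \<open>g\<close> to the universal covering, read off in a chart around each point.\<close>

definition lift_metric ::
  "(suspension_point, (real^8) \<times> (real^4)) bilinear_field \<Rightarrow>
   (real^8) \<times> (real^4) \<Rightarrow> (real^8) \<times> (real^4) \<Rightarrow> (real^8) \<times> (real^4) \<Rightarrow> real" where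
  "lift_metric g y = g (std_chart (ball y (1/2))) y"

lemma std_chart_ball: "std_chart (ball y (1/2)) \<in> S_atlas" "y \<in> chart_image (std_chart (ball y (1/2)))"
  by (auto simp: S_atlas_std_chart chart_image_std_chart inj_S_proj_ball intro!: exI[of _ "ball y (1/2)"])

context
  fixes g assumes hyper_hermitian: "hyper_hermitian_metric suspension_S g"
begin

lemma metric_deck:
  assumes "open W" "inj_on S_proj W" "open V" "inj_on S_proj V" "n \<in> lattice" "z \<in> W" "deck m n z \<in> V"
  shows "g (std_chart V) (deck m n z) (deck_lin m a) (deck_lin m b) = g (std_chart W) z a b"
proof -
  have "std_chart W \<in> S_atlas" "std_chart V \<in> S_atlas"
    using assms by (auto simp: S_atlas_std_chart)
  then have "g (std_chart V) (transition (std_chart W) (std_chart V) z)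
      (frechet_derivative (transition (std_chart W) (std_chart V)) (at z) a)
      (frechet_derivative (transition (std_chart W) (std_chart V)) (at z) b) = g (std_chart W) z a b"
    using hyper_hermitian std_chart_transition(1)[OF assms]
    unfolding hyper_hermitian_metric_def riemannian_metric_def by blast
  then show ?thesis by (simp add: std_chart_transition[OF assms])
qed

text \<open>The chart centred at y and \<open>std_chart W\<close> are related near y by the trivial
  deck transformation.\<close>

lemma lift_metric_eq:
  assumes "open W" "inj_on S_proj W" "y \<in> W"
  shows "lift_metric g y a b = g (std_chart W) y a b"
proof -
  have [simp]: "deck 0 0 y = y" "deck_lin 0 a = a" for a
    by (simp_all add: deck_def deck_lin_def A_pow_0 of_int_vec_simps split: prod.split)
  show ?thesis
    unfolding lift_metric_def
    using metric_deck[OF assms(1,2) open_ball inj_S_proj_ball lattice_0 assms(3), of 0 y a b] by simp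
qed

lemma lift_metric_deck:
  assumes "n \<in> lattice"
  shows "lift_metric g (deck m n y) (deck_lin m a) (deck_lin m b) = lift_metric g y a b"
  unfolding lift_metric_def
  by (rule metric_deck) (auto simp: inj_S_proj_ball assms)

lemma lift_metric_translation:
  assumes "n \<in> lattice"
  shows "lift_metric g (v + n, x) a b = lift_metric g (v, x) a b"
  using lift_metric_deck[OF assms, of 0 "(v, x)" a b]
  by (simp add: deck_def deck_lin_def A_pow_0 of_int_vec_simps split: prod.splits)

lemmas lift_metricD = hyper_hermitian_suspensionD[OF hyper_hermitian std_chart_ball(1) std_chart_ball(2),
    folded lift_metric_def]

lemma C1_lift_metric:
  "(\<lambda>y. lift_metric g y a b) differentiable (at y)"
  "continuous_on UNIV (\<lambda>y. frechet_derivative (\<lambda>y. lift_metric g y a b) (at y) v)"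
proof -
  have *: "\<exists>U f'. open U \<and> x \<in> U \<and> Ck_on (Suc 0) f' U \<and> (\<forall>z\<in>U. lift_metric g z a b = f' z)" for x
  proof (intro exI conjI ballI)
    let ?W = "ball x (1/2)"
    show "Ck_on (Suc 0) (\<lambda>z. g (std_chart ?W) z a b) ?W"
      using hyper_hermitian std_chart_ball(1)[of x] chart_image_std_chart[OF inj_S_proj_ball[of x]]
      unfolding hyper_hermitian_metric_def riemannian_metric_def smooth_on_def by metis
    show "lift_metric g z a b = g (std_chart ?W) z a b" if "z \<in> ?W" for z
      by (rule lift_metric_eq[OF open_ball inj_S_proj_ball that])
  qed auto
  show "(\<lambda>y. lift_metric g y a b) differentiable (at y)"
    "continuous_on UNIV (\<lambda>y. frechet_derivative (\<lambda>y. lift_metric g y a b) (at y) v)"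
    by (rule C1_locally[OF *])+
qed

lemma lift_metric_has_derivative:
  "((\<lambda>y. lift_metric g y a b) has_derivative frechet_derivative (\<lambda>y. lift_metric g y a b) (at y)) (at y)"
  using C1_lift_metric(1) frechet_derivative_works by blast

lemma continuous_lift_metric: "continuous_on X (\<lambda>y. lift_metric g y a b)"
  using has_derivative_continuous[OF lift_metric_has_derivative] continuous_at_imp_continuous_on by blast

text \<open>The real part of \<open>\<partial>\<Omega> = 0\<close> on the triple \<open>e\<close>, \<open>u\<close>, \<open>J u\<close>: the derivative of the squared
  length of \<open>u\<close> along \<open>e\<close> is a divergence along the quaternionic line of \<open>u\<close>.\<close>

lemma HKT_conservation_law:
  assumes HKT: "HKT_metric suspension_S g"
  defines "D \<equiv> \<lambda>y a b. frechet_derivative (\<lambda>y. lift_metric g y a b) (at y)"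
  shows "D y u u e = D y e u u + D y e (IS u) (IS u) + D y e (JS u) (JS u)
    + D y e (IS (JS u)) (IS (JS u))"
proof -
  define W where "W = ball y (1/2)"
  define c where "c = std_chart W"
  have W: "open W" "inj_on S_proj W" "y \<in> W" and c: "c \<in> S_atlas" "chart_image c = W"
    using std_chart_ball(1)[of y] chart_image_std_chart[OF inj_S_proj_ball[of y]]
    by (auto simp: W_def c_def inj_S_proj_ball)
  have D: "((\<lambda>y. lift_metric g y a b) has_derivative D y a b) (at y)" for a b
    unfolding D_def by (rule lift_metric_has_derivative)
  have Om: "Omega suspension_S g c z w = of_real (lift_metric g z (JS (w 0)) (w 1)) +
      \<i> * of_real (lift_metric g z (IS (JS (w 0))) (w 1))" if "z \<in> W" for z w
    by (simp add: Omega_suspension c_def lift_metric_eq[OF W(1,2) that])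
  have Om_deriv: "frechet_derivative (\<lambda>z. Omega suspension_S g c z w) (at y) =
      (\<lambda>v. of_real (D y a b v) + \<i> * of_real (D y a' b' v))"
    if "\<And>z. of_real (lift_metric g z (JS (w 0)) (w 1)) + \<i> * of_real (lift_metric g z (IS (JS (w 0))) (w 1))
        = of_real (lift_metric g z a b) + \<i> * of_real (lift_metric g z a' b')" for w a b a' b'
  proof -
    have "((\<lambda>z. of_real (lift_metric g z a b) + \<i> * of_real (lift_metric g z a' b')) has_derivative
        (\<lambda>v. of_real (D y a b v) + \<i> * of_real (D y a' b' v))) (at y)"
      by (intro derivative_intros D)
    then have "((\<lambda>z. Omega suspension_S g c z w) has_derivative
        (\<lambda>v. of_real (D y a b v) + \<i> * of_real (D y a' b' v))) (at y)"
      by (rule has_derivative_transform_within_open[OF _ W(1,3)]) (simp only: Om that)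
    then show ?thesis by (rule frechet_derivative_at[symmetric])
  qed
  have diff: "(\<lambda>z. Omega suspension_S g c z w) differentiable (at y)" for w
  proof -
    have "((\<lambda>z. of_real (lift_metric g z (JS (w 0)) (w 1)) + \<i> * of_real (lift_metric g z (IS (JS (w 0))) (w 1))) has_derivative
        (\<lambda>v. of_real (D y (JS (w 0)) (w 1) v) + \<i> * of_real (D y (IS (JS (w 0))) (w 1) v))) (at y)"
      by (intro derivative_intros D)
    then have "((\<lambda>z. Omega suspension_S g c z w) has_derivative
        (\<lambda>v. of_real (D y (JS (w 0)) (w 1) v) + \<i> * of_real (D y (IS (JS (w 0))) (w 1) v))) (at y)"
      by (rule has_derivative_transform_within_open[OF _ W(1,3)]) (simp add: Om)
    then show ?thesis by (rule differentiableI)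
  qed
  define v where "v = (\<lambda>i::nat. if i = 0 then e else if i = 1 then u else JS u)"
  have skew: "lift_metric g z (IS a) a = 0" for z a
    using lift_metricD(8)[of z a a] lift_metricD(2)[of z "IS a" a] by simp
  \<comment> \<open>On the pair u, J u the value of \<Omega> is the squared length of u, since I is
    skew; \<open>D y 0 0\<close> encodes the vanishing imaginary part. The other two faces become
    products with e.\<close>
  have f0: "frechet_derivative (\<lambda>z. Omega suspension_S g c z (face 0 v)) (at y) =
      (\<lambda>w. of_real (D y u u w) + \<i> * of_real (D y 0 0 w))"
    using skew by (intro Om_deriv)
      (simp add: face_def v_def lift_metricD(5) bilinear_lzero[OF lift_metricD(1)])
  have f1: "frechet_derivative (\<lambda>z. Omega suspension_S g c z (face 1 v)) (at y) =
      (\<lambda>w. of_real (D y e u w) + \<i> * of_real (D y e (IS u) w))"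
    by (intro Om_deriv)
      (simp add: face_def v_def lift_metricD(5,7-9) IS_JS_relations IS_minus JS_minus)
  have f2: "frechet_derivative (\<lambda>z. Omega suspension_S g c z (face 2 v)) (at y) =
      (\<lambda>w. of_real (D y e (- JS u) w) + \<i> * of_real (D y e (- IS (JS u)) w))"
    by (intro Om_deriv)
      (simp add: face_def v_def lift_metricD(5,7-9) IS_JS_relations IS_minus JS_minus)
  have D_minus: "D y e (- a) w = - D y e a w" for a w
  proof -
    have "((\<lambda>y. - lift_metric g y e a) has_derivative (\<lambda>w. - D y e a w)) (at y)"
      by (intro derivative_intros D)
    then have "((\<lambda>y. lift_metric g y e (- a)) has_derivative (\<lambda>w. - D y e a w)) (at y)"
      by (simp add: lift_metricD(7))
    then show ?thesis using has_derivative_unique[OF D] by metis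
  qed
  have D_0: "D y 0 0 w = 0" for w
    by (simp add: D_def bilinear_lzero[OF lift_metricD(1)])
  have "del (cxI suspension_S c) 2 (Omega suspension_S g c) y v = 0"
    using HKT c W(3) unfolding HKT_metric_def by blast
  moreover have "del (cxI suspension_S c) 2 (Omega suspension_S g c) y v = (\<Sum>i\<le>2. (-1) ^ i *
     (frechet_derivative (\<lambda>z. Omega suspension_S g c z (face i v)) (at y) (v i) -
      \<i> * frechet_derivative (\<lambda>z. Omega suspension_S g c z (face i v)) (at y) (IS (v i)))) / 2"
    unfolding cxI_suspension
    by (rule del_top_form[OF W(1,3)])
      (use Omega_suspension_top[OF hyper_hermitian c(1)] c(2) diff in auto)
  moreover have "{..2::nat} = {0, 1, 2}" by auto
  \<comment> \<open>The real part isolates the derivative along e; the derivative of the squared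
    length along \<open>IS e\<close> enters only the imaginary part.\<close>
  ultimately have "Re ((\<Sum>i\<in>{0, 1, 2}. (-1) ^ i *
     (frechet_derivative (\<lambda>z. Omega suspension_S g c z (face i v)) (at y) (v i) -
      \<i> * frechet_derivative (\<lambda>z. Omega suspension_S g c z (face i v)) (at y) (IS (v i))))) = 0"
    by simp
  then show ?thesis
    by (simp add: f0 f1[unfolded One_nat_def] f2 D_0 D_minus) (simp add: v_def)
qed

section \<open>Uniform bounds from the compactness of the torus\<close>

lemma lattice_translate:
  fixes v :: "real^8"
  obtains n where "n \<in> lattice" "v + n \<in> cbox 0 1"
proof
  show "(\<chi> i. - of_int \<lfloor>v $ i\<rfloor>) \<in> lattice" by (simp add: lattice_def)
  show "v + (\<chi> i. - of_int \<lfloor>v $ i\<rfloor>) \<in> cbox 0 1"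
    by (auto simp: mem_box_cart) linarith+
qed

text \<open>Periodicity moves v into the unit cube, so the bound is uniform in v although v ranges
  over a noncompact space.\<close>

lemma lift_metric_bounded:
  assumes "compact X"
  obtains M where "\<And>v x. x \<in> X \<Longrightarrow> \<bar>lift_metric g (v, x) a b\<bar> \<le> M"
proof -
  have "compact ((\<lambda>y. lift_metric g y a b) ` (cbox 0 1 \<times> X))"
    by (intro compact_continuous_image continuous_lift_metric compact_Times compact_cbox assms)
  then obtain M where M: "\<And>y. y \<in> cbox 0 1 \<times> X \<Longrightarrow> \<bar>lift_metric g y a b\<bar> \<le> M"
    unfolding bounded_iff[of "(\<lambda>y. lift_metric g y a b) ` _"] using compact_imp_bounded bounded_iff
    by (metis (no_types, lifting) image_eqI real_norm_def)
  have "\<bar>lift_metric g (v, x) a b\<bar> \<le> M" if "x \<in> X" for v x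
  proof -
    obtain n where "n \<in> lattice" "v + n \<in> cbox 0 1" by (rule lattice_translate)
    then show ?thesis using M[of "(v + n, x)"] that by (simp add: lift_metric_translation)
  qed
  then show ?thesis by (rule that)
qed

text \<open>\<delta> is the minimum over the unit cube times the unit sphere; periodicity in v and
  homogeneity in w extend the estimate.\<close>

lemma lift_metric_coercive:
  obtains \<delta> where "\<delta> > 0" "\<And>v w. \<delta> * (norm w)\<^sup>2 \<le> lift_metric g (v, 0) (w, 0) (w, 0)"
proof -
  define F where "F = (\<lambda>p. lift_metric g (fst p, 0) (snd p, 0) (snd p, 0))"
  define K where "K = cbox (0::real^8) 1 \<times> sphere (0::real^8) 1"
  \<comment> \<open>Continuity is available for fixed vector arguments only, so the varying vector
    is expanded in the basis.\<close>
  have "F p = (\<Sum>i\<in>Basis. \<Sum>j\<in>Basis. (snd p \<bullet> i) * ((snd p \<bullet> j) * lift_metric g (fst p, 0) (i, 0) (j, 0)))" for p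
  proof -
    note lin = lift_metricD(1)[of "(fst p, 0)", unfolded bilinear_def]
    have e: "(snd p, 0) = (\<Sum>i\<in>Basis. (snd p \<bullet> i) *\<^sub>R (i, 0))"
      by (simp add: prod_eq_iff fst_sum snd_sum euclidean_representation)
    have "F p = (\<Sum>i\<in>Basis. (snd p \<bullet> i) * lift_metric g (fst p, 0) (i, 0) (snd p, 0))"
    proof -
      have l: "linear (\<lambda>x. lift_metric g (fst p, 0) x (snd p, 0))" using lin by blast
      show ?thesis
        unfolding F_def by (subst (1) e) (simp only: linear_sum[OF l] linear_scale[OF l] real_scaleR_def)
    qed
    also have "\<dots> = (\<Sum>i\<in>Basis. (snd p \<bullet> i) * (\<Sum>j\<in>Basis. (snd p \<bullet> j) * lift_metric g (fst p, 0) (i, 0) (j, 0)))"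
    proof (rule sum.cong[OF refl])
      fix i :: "real^8"
      have "linear (lift_metric g (fst p, 0) (i, 0))" using lin by blast
      then have "lift_metric g (fst p, 0) (i, 0) (snd p, 0) = (\<Sum>j\<in>Basis. (snd p \<bullet> j) * lift_metric g (fst p, 0) (i, 0) (j, 0))"
        by (subst e) (simp add: linear_sum linear_scale del: scaleR_Pair)
      then show "(snd p \<bullet> i) * lift_metric g (fst p, 0) (i, 0) (snd p, 0) =
        (snd p \<bullet> i) * (\<Sum>j\<in>Basis. (snd p \<bullet> j) * lift_metric g (fst p, 0) (i, 0) (j, 0))" by simp
    qed
    finally show ?thesis by (simp add: sum_distrib_left)
  qed
  then have "continuous_on K F"
    by (subst continuous_on_cong[OF refl])
      (auto intro!: continuous_intros continuous_on_compose2[OF continuous_lift_metric[of UNIV]])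
  moreover have "(0, axis 1 1) \<in> K"
    by (simp add: K_def mem_box_cart norm_axis_1)
  then have "compact K" "K \<noteq> {}"
    by (auto simp: K_def intro!: compact_Times)
  ultimately obtain q where q: "q \<in> K" "\<And>p. p \<in> K \<Longrightarrow> F q \<le> F p"
    using continuous_attains_inf by metis
  have "(snd q, 0) \<noteq> (0 :: (real^8) \<times> (real^4))" using q(1) by (auto simp: K_def zero_prod_def)
  then have pos: "F q > 0" unfolding F_def by (rule lift_metricD(3))
  have "F q * (norm w)\<^sup>2 \<le> lift_metric g (v, 0) (w, 0) (w, 0)" for v w
  proof (cases "w = 0")
    case True
    then show ?thesis
      using bilinear_lzero[OF lift_metricD(1)] by (simp add: zero_prod_def[symmetric])
  next
    case False
    obtain n where n: "n \<in> lattice" "v + n \<in> cbox 0 1" by (rule lattice_translate)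
    define s where "s = w /\<^sub>R norm w"
    have "F q \<le> F (v + n, s)" using n False by (intro q(2)) (simp add: K_def s_def)
    also have "\<dots> = lift_metric g (v, 0) (s, 0) (s, 0)"
      by (simp add: F_def lift_metric_translation n(1))
    finally have "(norm w)\<^sup>2 * F q \<le> (norm w)\<^sup>2 * lift_metric g (v, 0) (s, 0) (s, 0)"
      by (rule mult_left_mono) simp
    then have "F q * (norm w)\<^sup>2 \<le> (norm w)\<^sup>2 * lift_metric g (v, 0) (s, 0) (s, 0)"
      by (simp only: mult.commute)
    also have "\<dots> = lift_metric g (v, 0) (norm w *\<^sub>R (s, 0)) (norm w *\<^sub>R (s, 0))"
      unfolding bilinear_lmul[OF lift_metricD(1)] bilinear_rmul[OF lift_metricD(1)]
      by (simp add: power2_eq_square)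
    also have "norm w *\<^sub>R (s, 0 :: real^4) = (w, 0)" using False by (simp add: s_def)
    finally show ?thesis .
  qed
  then show ?thesis using that pos by blast
qed

end

section \<open>Exponential growth against a conserved mean\<close>

lemma quat_form_le:
  assumes "linear l"
  obtains C where "C > 0" "\<And>v. quat_form l v v \<le> C * (norm v)\<^sup>2"
proof -
  have "\<exists>C>0. \<forall>v w. norm (quat_form l v w) \<le> C * norm v * norm w"
    using bilinear_quat_form[OF assms] bilinear_bounded_pos by blast
  then show ?thesis using that by (metis abs_le_D1 mult.assoc power2_eq_square real_norm_def)
qed

theorem no_HKT_metric: "\<not> HKT_metric suspension_S g"
proof
  assume HKT: "HKT_metric suspension_S g"
  then have hh: "hyper_hermitian_metric suspension_S g" by (simp add: HKT_metric_def)
  \<comment> \<open>The expanding functional does not vanish on this vector, so the powers of A make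
    it grow.\<close>
  define u :: "real^8" where "u = axis 1 1"
  define e :: "real^4" where "e = axis 1 1"
  \<comment> \<open>The four flux directions of \<open>HKT_conservation_law\<close> for u.\<close>
  define dir where "dir i = (if i = 0 then u else if i = 1 then I8 u else if i = 2 then J8 u else I8 (J8 u))"
    for i :: nat
  define D where "D y a b = frechet_derivative (\<lambda>y. lift_metric g y a b) (at y)" for y a b
  have D: "((\<lambda>y. lift_metric g y a b) has_derivative D y a b) (at y)" for y a b
    unfolding D_def by (rule lift_metric_has_derivative[OF hh])
  have cD: "continuous_on X (\<lambda>y. D y a b v)" for X a b v
    using C1_lift_metric(2)[OF hh] continuous_on_subset unfolding D_def by blast
  have law: "D (v, t *\<^sub>R e) (u, 0) (u, 0) (0, e) = (\<Sum>i<4. D (v, t *\<^sub>R e) (0, e) (dir i, 0) (dir i, 0))" for v t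
  proof -
    have "IS (a, 0) = (I8 a, 0)" "JS (a, 0) = (J8 a, 0)" for a
      by (simp_all add: IS_def JS_def linear_0 linear_IJ)
    then show ?thesis
      using HKT_conservation_law[OF hh HKT, where y = "(v, t *\<^sub>R e)" and u = "(u, 0)" and e = "(0, e)",
        folded D_def]
      by (simp add: eval_nat_numeral lessThan_Suc dir_def)
  qed
  obtain C1 where C1: "\<And>v. \<bar>lift_metric g (v, 0) (u, 0) (u, 0)\<bar> \<le> C1"
    using lift_metric_bounded[OF hh compact_sing[of 0], where a = "(u, 0)" and b = "(u, 0)"] by (metis singletonI)
  \<comment> \<open>\<open>C0\<close> bounds the mean at -n from below and \<open>C1\<close> the
    mean at 0 from above. The flux bound \<open>M\<close> may depend on n, whereas \<open>C1\<close>
    does not.\<close>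
  have le_C1: "C0 \<le> C1" if n: "n > 0" and C0: "\<And>v. C0 \<le> lift_metric g (v, - real n *\<^sub>R e) (u, 0) (u, 0)" for n C0
  proof -
    have "\<exists>M. \<forall>v x. x \<in> (\<lambda>t. t *\<^sub>R e) ` {- real n..0} \<longrightarrow> \<bar>lift_metric g (v, x) (0, e) (dir i, 0)\<bar> \<le> M" for i
    proof -
      have "compact ((\<lambda>t. t *\<^sub>R e) ` {- real n..0})"
        by (intro compact_continuous_image continuous_intros compact_Icc)
      then show ?thesis using lift_metric_bounded[OF hh] by metis
    qed
    then obtain M where M: "\<And>i v t. t \<in> {- real n..0} \<Longrightarrow> \<bar>lift_metric g (v, t *\<^sub>R e) (0, e) (dir i, 0)\<bar> \<le> M i"
      by (metis image_eqI)
    show ?thesis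
    proof (rule conservation_law_mean_le[where ta = "- real n" and tb = 0 and I = "{..<4::nat}"
          and a = "\<lambda>v t. lift_metric g (v, t *\<^sub>R e) (u, 0) (u, 0)"
          and b = "\<lambda>i v t. lift_metric g (v, t *\<^sub>R e) (0, e) (dir i, 0)"
          and a' = "\<lambda>v t. D (v, t *\<^sub>R e) (u, 0) (u, 0) (0, e)"
          and b' = "\<lambda>i v t. D (v, t *\<^sub>R e) (0, e) (dir i, 0) (dir i, 0)"
          and u = dir and M = "\<Sum>i<4. \<bar>M i\<bar>"])
      show "((\<lambda>t. lift_metric g (v, t *\<^sub>R e) (u, 0) (u, 0)) has_real_derivative
          D (v, t *\<^sub>R e) (u, 0) (u, 0) (0, e)) (at t)" for v t
      proof -
        have "((\<lambda>t. (v, t *\<^sub>R e)) has_derivative (\<lambda>s. (0, s *\<^sub>R e))) (at t)"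
          by (auto intro!: derivative_eq_intros)
        from has_derivative_compose[OF this D]
        show ?thesis
          using linear_scale[OF has_derivative_linear[OF D], of _ _ _ _ "(0, e)"]
          by (simp add: has_field_derivative_def mult_commute_abs)
      qed
      show "((\<lambda>s. lift_metric g (v + s *\<^sub>R dir i, t *\<^sub>R e) (0, e) (dir i, 0)) has_real_derivative
          D (v, t *\<^sub>R e) (0, e) (dir i, 0) (dir i, 0)) (at 0)" for i v t
      proof -
        have "((\<lambda>s. (v + s *\<^sub>R dir i, t *\<^sub>R e)) has_derivative (\<lambda>s. (s *\<^sub>R dir i, 0))) (at 0)"
          by (auto intro!: derivative_eq_intros)
        from has_derivative_compose[OF this D]
        show ?thesis
          using linear_scale[OF has_derivative_linear[OF D], of _ _ _ _ "(dir i, 0)"]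
          by (simp add: has_field_derivative_def mult_commute_abs)
      qed
      show "continuous_on UNIV (\<lambda>v. lift_metric g (v, t *\<^sub>R e) a b)" for t a b
        by (rule continuous_on_compose2[OF continuous_lift_metric[OF hh, of UNIV]]) (auto intro: continuous_intros)
      show "continuous_on UNIV (\<lambda>v. lift_metric g (v, t *\<^sub>R e) a b)" for t a b by fact
      show "continuous_on UNIV (\<lambda>(t, v). D (v, t *\<^sub>R e) (u, 0) (u, 0) (0, e))"
        unfolding case_prod_unfold
        by (rule continuous_on_compose2[OF cD[of UNIV]]) (auto intro!: continuous_intros)
      show "continuous_on UNIV (\<lambda>v. D (v, t *\<^sub>R e) (0, e) (dir i, 0) (dir i, 0))" for i t
        by (rule continuous_on_compose2[OF cD[of UNIV]]) (auto intro: continuous_intros)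
      show "\<bar>lift_metric g (v, t *\<^sub>R e) (0, e) (dir i, 0)\<bar> \<le> (\<Sum>i<4. \<bar>M i\<bar>)"
        if "i \<in> {..<4}" "- real n \<le> t" "t \<le> 0" for i v t
      proof -
        have "\<bar>lift_metric g (v, t *\<^sub>R e) (0, e) (dir i, 0)\<bar> \<le> \<bar>M i\<bar>"
          using M[of t v i] that by simp
        also have "\<dots> \<le> (\<Sum>i<4. \<bar>M i\<bar>)" using that by (intro member_le_sum) auto
        finally show ?thesis .
      qed
      show "lift_metric g (v, 0 *\<^sub>R e) (u, 0) (u, 0) \<le> C1" for v
        using C1[of v] by simp
    qed (use n C0 law in auto)
  qed
  obtain \<delta> where \<delta>: "\<delta> > 0" "\<And>v w. \<delta> * (norm w)\<^sup>2 \<le> lift_metric g (v, 0) (w, 0) (w, 0)"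
    using lift_metric_coercive[OF hh] by blast
  obtain C where C: "C > 0" "\<And>v. eigen_form (- sqrt 2) v v \<le> C * (norm v)\<^sup>2"
    using quat_form_le[OF linear_eigen_functional[of "- sqrt 2"]] unfolding eigen_form_def by blast
  define s where "s = eigen_form (- sqrt 2) (u, 0) (u, 0)"
  have s: "s > 0"
  proof -
    have "eigen_functional (- sqrt 2) u = - sqrt 2"
      by (simp add: eigen_functional_def u_def axis_def)
    then have "s \<noteq> 0" using quat_form_eq_0(1)[of _ "(u, 0)"] by (fastforce simp: s_def eigen_form_def)
    moreover have "s \<ge> 0" by (simp add: s_def eigen_form_def quat_form_nonneg)
    ultimately show ?thesis by simp
  qed
  \<comment> \<open>The deck transformation with first component n moves -n to 0 and u to
    \<open>A_pow (int n) u\<close>, where coercivity gives a bound independent of v.\<close>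
  have growth: "\<delta> / C * s * exp (dilation * n) \<le> lift_metric g (v, - real n *\<^sub>R e) (u, 0) (u, 0)" for n v
  proof -
    define m :: "int^4" where "m = axis 1 (int n)"
    have m: "m $ 1 = int n" "of_int_vec m = real n *\<^sub>R e"
      by (auto simp: m_def e_def of_int_vec_def vec_eq_iff axis_def)
    define w where "w = A_pow (int n) u"
    have "s * exp (dilation * n) = eigen_form (- sqrt 2) (w, 0) (w, 0)"
      using eigen_form_A_pow[of "- sqrt 2" dilation "int n" u 0 u 0] by (simp add: exp_dilation s_def w_def)
    also have "\<dots> \<le> C * (norm w)\<^sup>2" using C(2)[of "(w, 0)"] by (simp add: norm_Pair)
    finally have "\<delta> / C * (s * exp (dilation * n)) \<le> \<delta> / C * (C * (norm w)\<^sup>2)"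
      using C(1) \<delta>(1) by (intro mult_left_mono) auto
    also have "\<dots> = \<delta> * (norm w)\<^sup>2" using C(1) by simp
    also have "\<dots> \<le> lift_metric g (A_pow (int n) v, 0) (w, 0) (w, 0)" by (rule \<delta>(2))
    also have "\<dots> = lift_metric g (v, - real n *\<^sub>R e) (u, 0) (u, 0)"
      using lift_metric_deck[OF hh lattice_0, of m "(v, - real n *\<^sub>R e)" "(u, 0)" "(u, 0)"]
      by (simp add: deck_def deck_lin_def m w_def)
    finally show ?thesis by (simp add: mult.assoc)
  qed
  \<comment> \<open>With this n, \<open>exp x \<ge> 1 + x\<close> suffices for the contradiction;
    passing to \<open>Suc n\<close> gives the positive index that \<open>le_C1\<close>
    requires.\<close>
  obtain n :: nat where n: "(C1 / (\<delta> / C * s)) / dilation < n" using reals_Archimedean2 by blast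
  define N where "N = Suc n"
  have p: "\<delta> / C * s > 0" using s \<delta>(1) C(1) by simp
  have "\<delta> / C * s * exp (dilation * N) \<le> C1"
    by (rule le_C1[of N]) (use growth[of N] in \<open>auto simp: N_def\<close>)
  then have "exp (dilation * N) \<le> C1 / (\<delta> / C * s)" using p by (simp only: pos_le_divide_eq mult.commute)
  also have "\<dots> < dilation * n" using n dilation_pos by (simp only: pos_divide_less_eq mult.commute)
  also have "\<dots> \<le> dilation * N" using dilation_pos by (simp add: N_def)
  finally show False using exp_ge_add_one_self[of "dilation * N"] by linarith
qed

theorem theorem7p4:
  shows "(\<exists>g. quaternionic_balanced_metric suspension_S g) \<and>
         \<not> (\<exists>g. HKT_metric suspension_S g)"
  using quaternionic_balanced_form no_HKT_metric by blast

end
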